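(* With probability one there exists $n_0$ such that for every $n\ge n_0$ the function $\mathbb R^3\ni(\alpha',\mu'_\varepsilon,\theta')\mapsto Q_n(\mathbf Y_n;\alpha',\mu'_\varepsilon,\theta')$ has a unique global minimizer $(\hat\alpha_n,\hat\mu_{\varepsilon,n},\hat\theta_n)$, given by $$\hat\alpha_n=\frac{(n-1)\sum^{(s)}Y_{k-1}Y_k-\sum^{(s)}Y_k\sum^{(s)}Y_{k-1}}{D_n},\quad \hat\mu_{\varepsilon,n}=\frac{\sum^{(s)}Y_{k-1}^2\sum^{(s)}Y_k-\sum^{(s)}Y_{k-1}\sum^{(s)}Y_{k-1}Y_k}{D_n},\quad \hat\theta_n=Y_s-\hat\alpha_nY_{s-1}-\hat\mu_{\varepsilon,n},$$ where $\sum^{(s)}$ denotes $\sum_{k=1,k\ne s}^n$ and $D_n=(n-1)\sum^{(s)}Y_{k-1}^2-(\sum^{(s)}Y_{k-1})^2$. Moreover, for every $(\alpha,\mu_\varepsilon,\theta)\in(0,1)\times(0,\infty)\times\mathbb N$, almost surely $\hat\alpha_n\to\alpha$, $\hat\mu_{\varepsilon,n}\to\mu_\varepsilon$ and $\hat\theta_n\to Y_s-\alpha Y_{s-1}-\mu_\varepsilon$.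
   Context: INAR(1) with an innovational outlier: Let $\alpha\in(0,1)$. Let $(\varepsilon_k)_{k\in\mathbb N}$ be i.i.d. non-negative integer-valued random variables with $\mathbb E\varepsilon_1^2<\infty$ and $\mathbb P(\varepsilon_1\ne 0)>0$; write $\mu_\varepsilon=\mathbb E\varepsilon_1$. For each $k\in\mathbb N$ let $(\xi_{k,j})_{j\in\mathbb N}$ be i.i.d. Bernoulli random variables with mean $\alpha$, these sequences being mutually independent and independent of $(\varepsilon_k)$. Fix a known time $s\in\mathbb N$ and size $\theta\in\mathbb N$. Let $Y_0$ be a non-negative integer-valued random variable with $\mathbb E Y_0^2<\infty$, independent of all $\xi_{k,j},\varepsilon_k$, and set $Y_k=\sum_{j=1}^{Y_{k-1}}\xi_{k,j}+\varepsilon_k+\delta_{k,s}\theta$, $k\in\mathbb N$. Write $\mathbf Y_n=(Y_0,\dots,Y_n)$. For $n\ge s$, $$Q_n(\mathbf y_n;\alpha',\mu'_\varepsilon,\theta')=\sum_{\substack{k=1\\k\neq s}}^n(y_k-\alpha'y_{k-1}-\mu'_\varepsilon)^2+(y_s-\alpha'y_{s-1}-\mu'_\varepsilon-\theta')^2 .$$ *)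

theory Defs
  imports "HOL-Probability.Probability"
begin

text \<open>Index set for the primitive random variables of the INAR(1) model:
  the initial value Y0, the innovations eps_k (k >= 1) and the
  Bernoulli counting variables xi_{k,j} (k, j >= 1).\<close>
datatype inar_src = SrcY0 | SrcEps nat | SrcXi nat nat

definition inar_family ::
  "('a \<Rightarrow> nat) \<Rightarrow> (nat \<Rightarrow> 'a \<Rightarrow> nat) \<Rightarrow> (nat \<Rightarrow> nat \<Rightarrow> 'a \<Rightarrow> nat) \<Rightarrow> inar_src \<Rightarrow> 'a \<Rightarrow> nat"
  where
  "inar_family Y0 eps xi i =
     (case i of SrcY0 \<Rightarrow> Y0 | SrcEps k \<Rightarrow> eps k | SrcXi k j \<Rightarrow> xi k j)"

definition inar_index :: "inar_src set" where
  "inar_index = {SrcY0} \<union> SrcEps ` {1..} \<union> (\<lambda>(k, j). SrcXi k j) ` ({1..} \<times> {1..})"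

fun inarY ::
  "('a \<Rightarrow> nat) \<Rightarrow> (nat \<Rightarrow> 'a \<Rightarrow> nat) \<Rightarrow> (nat \<Rightarrow> nat \<Rightarrow> 'a \<Rightarrow> nat) \<Rightarrow> nat \<Rightarrow> nat \<Rightarrow> nat \<Rightarrow> 'a \<Rightarrow> nat"
  where
  "inarY Y0 eps xi s \<theta> 0 \<omega> = Y0 \<omega>"
| "inarY Y0 eps xi s \<theta> (Suc k) \<omega> =
     (\<Sum>j = 1..inarY Y0 eps xi s \<theta> k \<omega>. xi (Suc k) j \<omega>) + eps (Suc k) \<omega>
     + (if Suc k = s then \<theta> else 0)"

definition sumS :: "nat \<Rightarrow> nat \<Rightarrow> (nat \<Rightarrow> real) \<Rightarrow> real" where
  "sumS s n f = (\<Sum>k \<in> {1..n} - {s}. f k)"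

definition Qn :: "nat \<Rightarrow> nat \<Rightarrow> (nat \<Rightarrow> real) \<Rightarrow> real \<times> real \<times> real \<Rightarrow> real" where
  "Qn s n y p = (case p of (a, m, t) \<Rightarrow>
     (\<Sum>k \<in> {1..n} - {s}. (y k - a * y (k - 1) - m)\<^sup>2) + (y s - a * y (s - 1) - m - t)\<^sup>2)"

definition Dn :: "nat \<Rightarrow> nat \<Rightarrow> (nat \<Rightarrow> real) \<Rightarrow> real" where
  "Dn s n y = (real n - 1) * sumS s n (\<lambda>k. (y (k - 1))\<^sup>2) - (sumS s n (\<lambda>k. y (k - 1)))\<^sup>2"

definition alpha_hat :: "nat \<Rightarrow> nat \<Rightarrow> (nat \<Rightarrow> real) \<Rightarrow> real" where
  "alpha_hat s n y =
     ((real n - 1) * sumS s n (\<lambda>k. y (k - 1) * y k) - sumS s n y * sumS s n (\<lambda>k. y (k - 1)))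
     / Dn s n y"

definition mu_hat :: "nat \<Rightarrow> nat \<Rightarrow> (nat \<Rightarrow> real) \<Rightarrow> real" where
  "mu_hat s n y =
     (sumS s n (\<lambda>k. (y (k - 1))\<^sup>2) * sumS s n y
       - sumS s n (\<lambda>k. y (k - 1)) * sumS s n (\<lambda>k. y (k - 1) * y k))
     / Dn s n y"

definition theta_hat :: "nat \<Rightarrow> nat \<Rightarrow> (nat \<Rightarrow> real) \<Rightarrow> real" where
  "theta_hat s n y = y s - alpha_hat s n y * y (s - 1) - mu_hat s n y"

end

theory Submission
  imports Defs
begin

text \<open>
  Write \<open>d_k = Y_(k+1) - \<alpha> Y_k - \<mu>\<close> for the (martingale difference) errors, corrected by the
  outlier at time \<open>s\<close>, and \<open>B_n\<close> for the sum of \<open>(1 + Y_k)^2\<close> over \<open>k < n\<close>. The estimation errors are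
  quotients with denominator \<open>D_n\<close> and numerators bilinear in the sums of \<open>d_k\<close>, \<open>Y_k d_k\<close>, \<open>Y_k\<close>,
  \<open>Y_k^2\<close>, so it suffices that the sum of \<open>d_k\<close> is \<open>o(n)\<close>, that the sum of \<open>Y_k d_k\<close> is \<open>o(B_n)\<close>
  and that \<open>D_n \<ge> c n B_n\<close> eventually.

  With second moments only, \<open>Y_k d_k\<close> need not be square integrable. The strong laws are therefore
  self-normalized: if the conditional variances are at most \<open>C b(Y_k)^(3/2)\<close> with \<open>b \<ge> 1\<close>, then
  dividing the k-th difference by the predictable partial sum of the \<open>b(Y_i)\<close>, \<open>i \<le> k\<close>, leaves
  summable variances, because the sum of \<open>b_k / (b_0 + ... + b_k)^(3/2)\<close> is bounded by a constant
  whatever the \<open>b_k\<close> are. Kolmogorov's maximal inequality and Kronecker's lemma conclude.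

  For the lower bound on \<open>D_n\<close>, the sum of \<open>(Y_k - m)^2\<close>, where \<open>m = \<mu> / (1 - \<alpha>)\<close>, is at least
  \<open>B_n - (1 + m)^2 n - o(B_n)\<close>, and, since \<open>Y_(k+1)\<close> correlates with the bounded centred variable
  \<open>\<xi>_(k+1,1) - \<alpha>\<close> as soon as \<open>Y_k \<ge> 1\<close>, also at least \<open>c n - o(B_n)\<close>.
\<close>

subsection \<open>Strong law for martingale differences\<close>

text \<open>Since every weight is at least 1, the total weight diverges: the finitely many early
  terms contribute the constant \<open>K\<close>, which washes out, and the later ones average small
  values of \<open>t\<close>.\<close>

lemma weighted_cesaro:
  fixes b t :: "nat \<Rightarrow> real"
  assumes b: "\<And>k. 1 \<le> b k" and t: "t \<longlonglongrightarrow> 0"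
  shows "(\<lambda>n. (\<Sum>k<n. b k * t k) / (\<Sum>k<n. b k)) \<longlonglongrightarrow> 0"
proof (rule LIMSEQ_I)
  fix r :: real assume r: "0 < r"
  define B where "B n = (\<Sum>k<n. b k)" for n
  obtain N where N: "\<And>k. k \<ge> N \<Longrightarrow> \<bar>t k\<bar> < r / 2"
    using LIMSEQ_D[OF t, of "r/2"] r by auto
  define K where "K = (\<Sum>k<N. b k * \<bar>t k\<bar>)"
  have Bn: "real n \<le> B n" for n
    unfolding B_def using sum_mono[of "{..<n}" "\<lambda>_. 1" b] b by simp
  obtain N' where N': "2 * K / r < real N'" using reals_Archimedean2 by blast
  have bd: "\<bar>\<Sum>k<n. b k * t k\<bar> \<le> K + r / 2 * B n" if "n \<ge> N" for n
  proof -
    have "\<bar>\<Sum>k<n. b k * t k\<bar> \<le> (\<Sum>k<n. b k * \<bar>t k\<bar>)"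
    proof (rule order_trans[OF sum_abs], rule sum_mono)
      fix k show "\<bar>b k * t k\<bar> \<le> b k * \<bar>t k\<bar>" using b[of k] by (simp add: abs_mult)
    qed
    also have "\<dots> \<le> (\<Sum>k<n. (if k < N then b k * \<bar>t k\<bar> else 0) + r / 2 * b k)"
    proof (rule sum_mono)
      fix k
      show "b k * \<bar>t k\<bar> \<le> (if k < N then b k * \<bar>t k\<bar> else 0) + r / 2 * b k"
      proof (cases "k < N")
        case True
        then show ?thesis using b[of k] r by simp
      next
        case False
        then have "b k * \<bar>t k\<bar> \<le> b k * (r / 2)"
          using N[of k] b[of k] by (intro mult_left_mono) auto
        then show ?thesis using False by (simp add: mult.commute)
      qed
    qed
    also have "\<dots> = (\<Sum>k<n. if k < N then b k * \<bar>t k\<bar> else 0) + r / 2 * B n"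
      by (simp add: sum.distrib sum_distrib_left B_def)
    also have "(\<Sum>k<n. if k < N then b k * \<bar>t k\<bar> else 0) = K"
      unfolding K_def using that by (intro sum.mono_neutral_cong_right) auto
    finally show ?thesis .
  qed
  show "\<exists>no. \<forall>n\<ge>no. norm ((\<Sum>k<n. b k * t k) / (\<Sum>k<n. b k) - 0) < r"
  proof (intro exI allI impI)
    fix n assume n: "n \<ge> max (Suc N) N'"
    have "0 < B n" using Bn[of n] n by auto
    have "K < r / 2 * real N'" using N' r by (simp add: field_simps)
    also have "\<dots> \<le> r / 2 * B n" using Bn[of n] n r by (intro mult_left_mono) auto
    finally have "\<bar>\<Sum>k<n. b k * t k\<bar> < r * B n" using bd[of n] n by auto
    then show "norm ((\<Sum>k<n. b k * t k) / (\<Sum>k<n. b k) - 0) < r"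
      using \<open>0 < B n\<close> by (simp add: B_def[symmetric] pos_divide_less_eq abs_divide)
  qed
qed

text \<open>The weights \<open>b\<close> are the increments of the normalizer, so summation by parts
  against the tails \<open>t\<close> of the convergent series reduces the claim to a weighted Cesaro
  mean of these tails.\<close>

lemma kronecker:
  fixes b d :: "nat \<Rightarrow> real"
  assumes b: "\<And>k. 1 \<le> b k" and conv: "summable (\<lambda>k. d k / (\<Sum>i\<le>k. b i))"
  shows "(\<lambda>n. (\<Sum>k<n. d k) / (\<Sum>k<n. b k)) \<longlonglongrightarrow> 0"
proof -
  define B where "B n = (\<Sum>k<n. b k)" for n
  define x where "x k = d k / B (Suc k)" for k
  have Bn: "real n \<le> B n" for n
    unfolding B_def using sum_mono[of "{..<n}" "\<lambda>_. 1" b] b by simp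
  have Bpos: "0 < B (Suc n)" for n using Bn[of "Suc n"] by auto
  have sx: "summable x" using conv by (simp add: x_def[abs_def] B_def lessThan_Suc_atMost)
  define t where "t n = suminf x - (\<Sum>k<n. x k)" for n
  have t: "t \<longlonglongrightarrow> 0"
    unfolding t_def[abs_def] using summable_LIMSEQ[OF sx] by (auto intro!: tendsto_eq_intros)
  have tS: "t (Suc n) = t n - x n" for n by (simp add: t_def)
  \<comment> \<open>Abel summation, from \<open>d n = B (Suc n) * (t n - t (Suc n))\<close>.\<close>
  have parts: "(\<Sum>k<n. d k) = (\<Sum>k<n. b k * t k) - B n * t n" for n
  proof (induction n)
    case 0 then show ?case by (simp add: B_def)
  next
    case (Suc n)
    have "B (Suc n) * x n = d n" using Bpos[of n] by (simp add: x_def)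
    moreover have "B (Suc n) = B n + b n" by (simp add: B_def)
    ultimately show ?case using Suc by (simp add: tS algebra_simps)
  qed
  have "(\<lambda>n. (\<Sum>k<n. b k * t k) / B n - t n) \<longlonglongrightarrow> 0 - 0"
    unfolding B_def by (intro tendsto_diff weighted_cesaro b t)
  moreover have "\<forall>\<^sub>F n in sequentially. (\<Sum>k<n. b k * t k) / B n - t n = (\<Sum>k<n. d k) / B n"
    using eventually_gt_at_top[of 0]
  proof eventually_elim
    case (elim n)
    then have "B n > 0" using Bn[of n] by auto
    then show ?case by (simp add: parts diff_divide_distrib)
  qed
  ultimately show ?thesis unfolding B_def[symmetric] by (simp add: tendsto_cong)
qed

section \<open>Maximal inequality and convergence for square integrable martingale
  differences\<close>

lemma integrable_mult_of_squares:
  fixes f g :: "'a \<Rightarrow> real"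
  assumes [measurable]: "f \<in> borel_measurable M" "g \<in> borel_measurable M"
    and "integrable M (\<lambda>x. (f x)\<^sup>2)" "integrable M (\<lambda>x. (g x)\<^sup>2)"
  shows "integrable M (\<lambda>x. f x * g x)"
proof (rule Bochner_Integration.integrable_bound)
  show "integrable M (\<lambda>x. (f x)\<^sup>2 + (g x)\<^sup>2)" using assms by simp
  have "\<bar>a * b\<bar> \<le> a\<^sup>2 + b\<^sup>2" for a b :: real
  proof -
    have "0 \<le> (a + b)\<^sup>2" "0 \<le> (a - b)\<^sup>2" "0 \<le> a\<^sup>2" "0 \<le> b\<^sup>2" by auto
    then show ?thesis by (auto simp: power2_eq_square algebra_simps abs_le_iff)
  qed
  then show "AE x in M. norm (f x * g x) \<le> norm ((f x)\<^sup>2 + (g x)\<^sup>2)" by auto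
qed simp

lemma subalgebra_chain:
  assumes mono: "\<And>n. subalgebra (F (Suc n)) (F n)" and "m \<le> n"
  shows "subalgebra (F n) (F m)"
  using \<open>m \<le> n\<close>
proof (induction rule: dec_induct)
  case base show ?case by (simp add: subalgebra_def)
next
  case (step n) then show ?case using mono[of n] by (auto simp: subalgebra_def)
qed

context prob_space
begin

text \<open>Stop the walk when it first leaves the band of width \<open>r\<close> and apply Markov's
  inequality to the square of the stopped walk. The martingale difference property enters as
  orthogonality to every square integrable variable known at time \<open>n\<close>, which avoids
  conditional expectations.\<close>

lemma kolmogorov_maximal_inequality:
  fixes X :: "nat \<Rightarrow> 'a \<Rightarrow> real"
  assumes sub: "\<And>n. subalgebra M (F n)"
    and mono: "\<And>n. subalgebra (F (Suc n)) (F n)"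
    and meas: "\<And>n. X n \<in> borel_measurable (F (Suc n))"
    and sq: "\<And>n. integrable M (\<lambda>\<omega>. (X n \<omega>)\<^sup>2)"
    and orth: "\<And>n W. W \<in> borel_measurable (F n) \<Longrightarrow> integrable M (\<lambda>\<omega>. (W \<omega>)\<^sup>2) \<Longrightarrow>
                 expectation (\<lambda>\<omega>. W \<omega> * X n \<omega>) = 0"
    and r: "0 < r"
  shows "prob {\<omega> \<in> space M. \<exists>n\<le>N. r \<le> \<bar>\<Sum>k<n. X k \<omega>\<bar>} \<le> (\<Sum>k<N. expectation (\<lambda>\<omega>. (X k \<omega>)\<^sup>2)) / r\<^sup>2"
proof -
  define S where "S n \<omega> = (\<Sum>k<n. X k \<omega>)" for n \<omega>
  \<comment> \<open>\<open>G n\<close> indicates that the walk has stayed inside the band up to time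
    \<open>n\<close>; it is known at time \<open>n\<close>. Hence \<open>Z\<close> below is the walk
    stopped at its first exit.\<close>
  define G :: "nat \<Rightarrow> 'a \<Rightarrow> real" where "G n \<omega> = (if \<forall>j\<le>n. \<bar>S j \<omega>\<bar> < r then 1 else 0)" for n \<omega>
  define Z where "Z n \<omega> = (\<Sum>k<n. G k \<omega> * X k \<omega>)" for n \<omega>
  note mono' = subalgebra_chain[of F, OF mono]
  have Xm: "X k \<in> borel_measurable (F n)" if "k < n" for k n
    by (rule measurable_from_subalg[OF mono' meas]) (use that in auto)
  have Sm: "S j \<in> borel_measurable (F n)" if "j \<le> n" for j n
    unfolding S_def[abs_def] using that by (intro borel_measurable_sum Xm) auto
  have Gm: "G n \<in> borel_measurable (F n)" for n
  proof -
    have "Measurable.pred (F n) (\<lambda>\<omega>. \<forall>j\<in>{..n}. \<bar>S j \<omega>\<bar> < r)"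
    proof (intro pred_intros_finite)
      fix j assume "j \<in> {..n}"
      then have [measurable]: "S j \<in> borel_measurable (F n)" using Sm by auto
      show "Measurable.pred (F n) (\<lambda>\<omega>. \<bar>S j \<omega>\<bar> < r)" by measurable
    qed auto
    moreover have "G n = (\<lambda>\<omega>. if \<forall>j\<in>{..n}. \<bar>S j \<omega>\<bar> < r then 1 else 0)"
      by (auto simp: G_def)
    ultimately show ?thesis by (simp add: measurable_If)
  qed
  have GXm: "(\<lambda>\<omega>. G k \<omega> * X k \<omega>) \<in> borel_measurable (F n)" if "k < n" for k n
    using measurable_from_subalg[OF mono'[of k n] Gm] Xm[OF that] that by simp
  have Zm: "Z n \<in> borel_measurable (F n)" for n
    unfolding Z_def[abs_def] by (intro borel_measurable_sum GXm) auto
  note toM = measurable_from_subalg[OF sub]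
  have [measurable]: "X n \<in> borel_measurable M" "G n \<in> borel_measurable M" "Z n \<in> borel_measurable M"
      "S n \<in> borel_measurable M" for n
    using toM[OF meas] toM[OF Gm] toM[OF Zm] toM[OF Sm[OF order_refl]] by auto
  have G01: "G n \<omega> = 0 \<or> G n \<omega> = 1" for n \<omega> by (simp add: G_def)
  have GX: "integrable M (\<lambda>\<omega>. (G n \<omega> * X n \<omega>)\<^sup>2)"
       "expectation (\<lambda>\<omega>. (G n \<omega> * X n \<omega>)\<^sup>2) \<le> expectation (\<lambda>\<omega>. (X n \<omega>)\<^sup>2)" for n
  proof -
    have le: "(G n \<omega> * X n \<omega>)\<^sup>2 \<le> (X n \<omega>)\<^sup>2" for \<omega> using G01[of n \<omega>] by auto
    show int: "integrable M (\<lambda>\<omega>. (G n \<omega> * X n \<omega>)\<^sup>2)"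
      by (rule Bochner_Integration.integrable_bound[OF sq[of n]]) (use le in auto)
    show "expectation (\<lambda>\<omega>. (G n \<omega> * X n \<omega>)\<^sup>2) \<le> expectation (\<lambda>\<omega>. (X n \<omega>)\<^sup>2)"
      using int sq le by (intro integral_mono) auto
  qed
  have Z2: "integrable M (\<lambda>\<omega>. (Z n \<omega>)\<^sup>2) \<and>
      expectation (\<lambda>\<omega>. (Z n \<omega>)\<^sup>2) \<le> (\<Sum>k<n. expectation (\<lambda>\<omega>. (X k \<omega>)\<^sup>2))" for n
  proof (induction n)
    case 0 then show ?case by (simp add: Z_def)
  next
    case (Suc n)
    have ZG: "integrable M (\<lambda>\<omega>. (Z n \<omega> * G n \<omega>)\<^sup>2)"
    proof (rule Bochner_Integration.integrable_bound[of M "\<lambda>\<omega>. (Z n \<omega>)\<^sup>2"])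
      have "(Z n \<omega> * G n \<omega>)\<^sup>2 \<le> (Z n \<omega>)\<^sup>2" for \<omega> using G01[of n \<omega>] by auto
      then show "AE \<omega> in M. norm ((Z n \<omega> * G n \<omega>)\<^sup>2) \<le> norm ((Z n \<omega>)\<^sup>2)" by auto
    qed (use Suc in auto)
    \<comment> \<open>\<open>Z n * G n\<close> depends only on what is known at time
      \<open>n\<close>, so it is an admissible test variable and the mixed term of the square
      vanishes in mean.\<close>
    have cross: "expectation (\<lambda>\<omega>. (Z n \<omega> * G n \<omega>) * X n \<omega>) = 0"
      using Zm[of n] Gm[of n] by (intro orth ZG) auto
    have icross: "integrable M (\<lambda>\<omega>. (Z n \<omega> * G n \<omega>) * X n \<omega>)"
      using integrable_mult_of_squares[OF _ _ ZG sq[of n]] by auto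
    have eq: "(Z (Suc n) \<omega>)\<^sup>2 = (Z n \<omega>)\<^sup>2 + 2 * ((Z n \<omega> * G n \<omega>) * X n \<omega>) + (G n \<omega> * X n \<omega>)\<^sup>2" for \<omega>
      by (simp add: Z_def power2_sum algebra_simps)
    show ?case unfolding eq using Suc icross GX[of n] cross by simp
  qed
  \<comment> \<open>Before the first exit all factors \<open>G k\<close> are 1 and \<open>Z\<close>
    agrees with \<open>S\<close>; from then on they are 0 and \<open>Z\<close> keeps its exit
    value.\<close>
  have stop: "(\<exists>n\<le>N. r \<le> \<bar>S n \<omega>\<bar>) \<Longrightarrow> r \<le> \<bar>Z N \<omega>\<bar>" for \<omega>
  proof (induction N)
    case 0 then show ?case using r by (auto simp: S_def)
  next
    case (Suc N)
    show ?case
    proof (cases "\<exists>n\<le>N. r \<le> \<bar>S n \<omega>\<bar>")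
      case True
      then have "G N \<omega> = 0" by (auto simp: G_def not_less)
      then show ?thesis using Suc True by (simp add: Z_def)
    next
      case False
      then have "r \<le> \<bar>S (Suc N) \<omega>\<bar>" using Suc(2) le_Suc_eq by auto
      moreover have "G k \<omega> = 1" if "k \<le> N" for k using False that unfolding G_def
        by (metis (mono_tags) not_le order_trans)
      then have "Z (Suc N) \<omega> = S (Suc N) \<omega>" by (simp add: Z_def S_def)
      ultimately show ?thesis by simp
    qed
  qed
  have "prob {\<omega> \<in> space M. \<exists>n\<le>N. r \<le> \<bar>S n \<omega>\<bar>} \<le> prob {\<omega> \<in> space M. r\<^sup>2 \<le> (Z N \<omega>)\<^sup>2}"
  proof (rule finite_measure_mono)
    show "{\<omega> \<in> space M. \<exists>n\<le>N. r \<le> \<bar>S n \<omega>\<bar>} \<subseteq> {\<omega> \<in> space M. r\<^sup>2 \<le> (Z N \<omega>)\<^sup>2}"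
      using stop r by (auto simp: abs_le_square_iff[symmetric])
  qed measurable
  also have "\<dots> \<le> expectation (\<lambda>\<omega>. (Z N \<omega>)\<^sup>2) / r\<^sup>2"
    using Z2[of N] r by (intro integral_Markov_inequality_measure[where A="space M"]) auto
  also have "\<dots> \<le> (\<Sum>k<N. expectation (\<lambda>\<omega>. (X k \<omega>)\<^sup>2)) / r\<^sup>2"
    using Z2[of N] by (intro divide_right_mono) auto
  finally show ?thesis by (simp add: S_def)
qed

text \<open>The maximal inequality for the walk restarted at time \<open>m\<close> bounds the chance
  of a large later deviation by a tail of the variance series. Letting \<open>m\<close> grow yields
  the Cauchy criterion almost surely.\<close>

lemma orthogonal_increments_summable:
  fixes X :: "nat \<Rightarrow> 'a \<Rightarrow> real"
  assumes sub: "\<And>n. subalgebra M (F n)"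
    and mono: "\<And>n. subalgebra (F (Suc n)) (F n)"
    and meas: "\<And>n. X n \<in> borel_measurable (F (Suc n))"
    and sq: "\<And>n. integrable M (\<lambda>\<omega>. (X n \<omega>)\<^sup>2)"
    and orth: "\<And>n W. W \<in> borel_measurable (F n) \<Longrightarrow> integrable M (\<lambda>\<omega>. (W \<omega>)\<^sup>2) \<Longrightarrow>
                 expectation (\<lambda>\<omega>. W \<omega> * X n \<omega>) = 0"
    and summ: "summable (\<lambda>n. expectation (\<lambda>\<omega>. (X n \<omega>)\<^sup>2))"
  shows "AE \<omega> in M. summable (\<lambda>n. X n \<omega>)"
proof -
  define v where "v n = expectation (\<lambda>\<omega>. (X n \<omega>)\<^sup>2)" for n
  have v0: "0 \<le> v n" for n by (simp add: v_def)
  have sv: "summable v" using summ by (simp add: v_def[abs_def])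
  have [measurable]: "X n \<in> borel_measurable M" for n by (rule measurable_from_subalg[OF sub meas])
  define bad where "bad r m = {\<omega> \<in> space M. \<exists>n. r \<le> \<bar>\<Sum>k<n. X (k + m) \<omega>\<bar>}" for r :: real and m
  have [measurable]: "bad r m \<in> events" for r m unfolding bad_def by measurable
  have tail: "prob (bad r m) \<le> (\<Sum>k. v (k + m)) / r\<^sup>2" if r: "0 < r" for r m
  proof -
    \<comment> \<open>The maximal inequality has a finite horizon; the events \<open>E N\<close>
      increase to \<open>bad r m\<close>, so the bound survives the limit.\<close>
    define E where "E N = {\<omega> \<in> space M. \<exists>n\<le>N. r \<le> \<bar>\<Sum>k<n. X (k + m) \<omega>\<bar>}" for N :: nat
    have Em: "E N \<in> events" for N unfolding E_def by measurable
    have "incseq E" unfolding E_def incseq_def by (auto intro: order_trans)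
    then have lim: "(\<lambda>N. prob (E N)) \<longlonglongrightarrow> prob (\<Union>N. E N)"
      using Em by (intro finite_Lim_measure_incseq) auto
    have "(\<Union>N. E N) = bad r m" unfolding E_def bad_def by auto
    moreover have "prob (E N) \<le> (\<Sum>k. v (k + m)) / r\<^sup>2" for N
    proof -
      have "prob (E N) \<le> (\<Sum>k<N. expectation (\<lambda>\<omega>. (X (k + m) \<omega>)\<^sup>2)) / r\<^sup>2"
        unfolding E_def
        by (rule kolmogorov_maximal_inequality[of "\<lambda>n. F (n + m)"]) (use assms r in auto)
      also have "\<dots> \<le> (\<Sum>k. v (k + m)) / r\<^sup>2"
        unfolding v_def[symmetric] using sv v0
        by (intro divide_right_mono sum_le_suminf summable_ignore_initial_segment) auto
      finally show ?thesis .
    qed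
    ultimately show ?thesis using LIMSEQ_le_const2[OF lim] by auto
  qed
  have null: "AE \<omega> in M. \<exists>m. \<omega> \<notin> bad r m" if r: "0 < r" for r
  proof -
    have "(\<lambda>m. (\<Sum>k. v (k + m)) / r\<^sup>2) \<longlonglongrightarrow> 0 / r\<^sup>2"
      using suminf_exist_split2[OF sv] r by (intro tendsto_divide) auto
    then have lim: "(\<lambda>m. (\<Sum>k. v (k + m)) / r\<^sup>2) \<longlonglongrightarrow> 0" by simp
    have "prob (\<Inter>m. bad r m) \<le> (\<Sum>k. v (k + m)) / r\<^sup>2" for m
      by (rule order_trans[OF finite_measure_mono tail[OF r]]) auto
    then have "prob (\<Inter>m. bad r m) \<le> 0"
      by (intro LIMSEQ_le_const[OF lim]) auto
    then have "prob (\<Inter>m. bad r m) = 0" using measure_nonneg[of M "\<Inter>m. bad r m"] by linarith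
    then have "(\<Inter>m. bad r m) \<in> null_sets M"
      by (auto simp: null_sets_def emeasure_eq_measure)
    then show ?thesis by (rule AE_I') auto
  qed
  have "AE \<omega> in M. \<forall>i::nat. \<exists>m. \<omega> \<notin> bad (1 / Suc i) m"
    unfolding AE_all_countable by (intro allI null) auto
  then show ?thesis
  proof (rule AE_mp, intro AE_I2 impI)
    fix \<omega> assume \<omega>: "\<omega> \<in> space M" and good: "\<forall>i::nat. \<exists>m. \<omega> \<notin> bad (1 / Suc i) m"
    show "summable (\<lambda>n. X n \<omega>)"
      unfolding summable_Cauchy
    proof (intro allI impI)
      fix e :: real assume "0 < e"
      \<comment> \<open>Half of \<open>e\<close>, because a block from \<open>m\<close> to
        \<open>n\<close> is the difference of two blocks that start at \<open>M0\<close>.\<close>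
      then obtain i :: nat where i: "1 / Suc i < e / 2" using nat_approx_posE[of "e/2"] by auto
      obtain M0 where M0: "\<omega> \<notin> bad (1 / Suc i) M0" using good by blast
      have sm: "\<bar>sum (\<lambda>n. X n \<omega>) {M0..<M0 + n}\<bar> < e / 2" for n
      proof -
        have "sum (\<lambda>n. X n \<omega>) {M0..<M0 + n} = (\<Sum>k<n. X (k + M0) \<omega>)"
          using sum.shift_bounds_nat_ivl[of "\<lambda>n. X n \<omega>" 0 M0 n]
          by (simp add: add.commute lessThan_atLeast0)
        moreover have "\<bar>\<Sum>k<n. X (k + M0) \<omega>\<bar> < 1 / Suc i"
          using M0 \<omega> by (simp add: bad_def not_le)
        ultimately show ?thesis using i by linarith
      qed
      show "\<exists>N. \<forall>m\<ge>N. \<forall>n. norm (sum (\<lambda>n. X n \<omega>) {m..<n}) < e"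
      proof (intro exI allI impI)
        fix m n assume m: "M0 \<le> m"
        show "norm (sum (\<lambda>n. X n \<omega>) {m..<n}) < e"
        proof (cases "m \<le> n")
          case True
          have "sum (\<lambda>n. X n \<omega>) {m..<n} = sum (\<lambda>n. X n \<omega>) {M0..<n} - sum (\<lambda>n. X n \<omega>) {M0..<m}"
            using sum.atLeastLessThan_concat[OF m True, of "\<lambda>n. X n \<omega>"] by simp
          then show ?thesis using sm[of "n - M0"] sm[of "m - M0"] m True by simp
        qed (use \<open>0 < e\<close> in simp)
      qed
    qed
  qed
qed

section \<open>Inserting a random state into independent noise\<close>

lemma indep_var_of_indep_set:
  assumes sub: "subalgebra M F" "subalgebra M H" and ind: "indep_set (sets F) (sets H)"
    and Z: "Z \<in> measurable F N" and U: "U \<in> measurable H N'"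
  shows "indep_var N Z N' U"
  unfolding indep_var_eq
proof (intro conjI)
  show "random_variable N Z" "random_variable N' U"
    using measurable_from_subalg sub Z U by blast+
  have sp: "space F = space M" "space H = space M" using sub by (auto simp: subalgebra_def)
  have "sigma_sets (space M) {Z -` A \<inter> space M |A. A \<in> sets N} \<subseteq> sets F"
    unfolding sp(1)[symmetric] using measurable_sets[OF Z]
    by (intro sets.sigma_sets_subset) blast
  moreover have "sigma_sets (space M) {U -` A \<inter> space M |A. A \<in> sets N'} \<subseteq> sets H"
    unfolding sp(2)[symmetric] using measurable_sets[OF U]
    by (intro sets.sigma_sets_subset) blast
  ultimately show "indep_set (sigma_sets (space M) {Z -` A \<inter> space M |A. A \<in> sets N})
       (sigma_sets (space M) {U -` A \<inter> space M |A. A \<in> sets N'})"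
    using ind unfolding indep_sets2_eq by blast
qed

text \<open>Substitute for conditioning on \<open>F\<close>: split along the countably many values
  \<open>y\<close> of \<open>Y\<close>. On each slice \<open>W\<close> restricted to
  \<open>Y = y\<close> is independent of \<open>U y\<close>, so the mean factors and vanishes;
  dominated convergence adds up the slices.\<close>

lemma expectation_frozen_eq_0:
  fixes W :: "'a \<Rightarrow> real" and Y :: "'a \<Rightarrow> nat" and U :: "nat \<Rightarrow> 'a \<Rightarrow> real"
  assumes sub: "subalgebra M F" "subalgebra M H" and ind: "indep_set (sets F) (sets H)"
    and Wm: "W \<in> borel_measurable F" and Ym: "Y \<in> measurable F (count_space UNIV)"
    and Um: "\<And>y. U y \<in> borel_measurable H"
    and W: "integrable M W" and U: "\<And>y. integrable M (U y)" and U0: "\<And>y. expectation (U y) = 0"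
    and WU: "integrable M (\<lambda>\<omega>. W \<omega> * U (Y \<omega>) \<omega>)"
  shows "expectation (\<lambda>\<omega>. W \<omega> * U (Y \<omega>) \<omega>) = 0"
proof -
  note [measurable] = Wm Ym Um measurable_from_subalg[OF sub(1) Wm] measurable_from_subalg[OF sub(1) Ym]
     measurable_from_subalg[OF sub(2) Um]
  define Z where "Z y \<omega> = indicator {y} (Y \<omega>) * W \<omega>" for y \<omega>
  have Zm: "Z y \<in> borel_measurable F" for y
    unfolding Z_def[abs_def] using measurable_compose[OF Ym, of "indicator {y}" borel] Wm
    by (intro borel_measurable_times) auto
  have Zi: "integrable M (Z y)" for y
    by (rule Bochner_Integration.integrable_bound[OF W])
       (auto simp: Z_def[abs_def] indicator_def)
  have ZU: "integrable M (\<lambda>\<omega>. Z y \<omega> * U y \<omega>)" "expectation (\<lambda>\<omega>. Z y \<omega> * U y \<omega>) = 0" for y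
    using indep_var_integrable[OF indep_var_of_indep_set[OF sub ind Zm Um] Zi U, of y]
      indep_var_lebesgue_integral[OF indep_var_of_indep_set[OF sub ind Zm Um] Zi U, of y] U0
    by auto
  \<comment> \<open>Only the slice \<open>y = Y \<omega>\<close> is nonzero, so a partial sum is the
    integrand cut off to \<open>Y \<omega> < N\<close>, and the integrand itself dominates
    it.\<close>
  have eq: "(\<Sum>y<N. Z y \<omega> * U y \<omega>) = (if Y \<omega> < N then W \<omega> * U (Y \<omega>) \<omega> else 0)" for N \<omega>
  proof -
    have "(\<Sum>y<N. Z y \<omega> * U y \<omega>) = (\<Sum>y<N. if y = Y \<omega> then W \<omega> * U (Y \<omega>) \<omega> else 0)"
      by (intro sum.cong) (auto simp: Z_def)
    then show ?thesis by simp
  qed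
  have "(\<lambda>N. expectation (\<lambda>\<omega>. \<Sum>y<N. Z y \<omega> * U y \<omega>)) \<longlonglongrightarrow> expectation (\<lambda>\<omega>. W \<omega> * U (Y \<omega>) \<omega>)"
  proof (rule integral_dominated_convergence[where w="\<lambda>\<omega>. \<bar>W \<omega> * U (Y \<omega>) \<omega>\<bar>"])
    show "(\<lambda>\<omega>. W \<omega> * U (Y \<omega>) \<omega>) \<in> borel_measurable M" using WU by auto
    show "(\<lambda>\<omega>. \<Sum>y<N. Z y \<omega> * U y \<omega>) \<in> borel_measurable M" for N
      using ZU(1) by (intro borel_measurable_sum) auto
    show "integrable M (\<lambda>\<omega>. \<bar>W \<omega> * U (Y \<omega>) \<omega>\<bar>)" using WU by auto
    show "AE \<omega> in M. (\<lambda>N. \<Sum>y<N. Z y \<omega> * U y \<omega>) \<longlonglongrightarrow> W \<omega> * U (Y \<omega>) \<omega>"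
    proof (rule AE_I2)
      fix \<omega>
      show "(\<lambda>N. \<Sum>y<N. Z y \<omega> * U y \<omega>) \<longlonglongrightarrow> W \<omega> * U (Y \<omega>) \<omega>"
        unfolding eq
      proof (rule tendsto_eventually)
        show "\<forall>\<^sub>F N in sequentially. (if Y \<omega> < N then W \<omega> * U (Y \<omega>) \<omega> else 0) = W \<omega> * U (Y \<omega>) \<omega>"
          using eventually_gt_at_top[of "Y \<omega>"] by eventually_elim simp
      qed
    qed
    show "AE \<omega> in M. norm (\<Sum>y<N. Z y \<omega> * U y \<omega>) \<le> \<bar>W \<omega> * U (Y \<omega>) \<omega>\<bar>" for N
      unfolding eq by auto
  qed
  moreover have "expectation (\<lambda>\<omega>. \<Sum>y<N. Z y \<omega> * U y \<omega>) = 0" for N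
    using ZU by simp
  ultimately show ?thesis using LIMSEQ_unique[OF tendsto_const] by fastforce
qed

text \<open>The same slicing for second moments. Integrability of the product is now a conclusion,
  so the slices are summed as extended nonnegative integrals, where the interchange of sum and
  integral is free.\<close>

lemma frozen_square_integrable:
  fixes W :: "'a \<Rightarrow> real" and Y :: "'a \<Rightarrow> nat" and U :: "nat \<Rightarrow> 'a \<Rightarrow> real"
  assumes sub: "subalgebra M F" "subalgebra M H" and ind: "indep_set (sets F) (sets H)"
    and Wm: "W \<in> borel_measurable F" and Ym: "Y \<in> measurable F (count_space UNIV)"
    and Um: "\<And>y. U y \<in> borel_measurable H"
    and W0: "\<And>\<omega>. 0 \<le> W \<omega>" and W: "integrable M W"
    and U: "\<And>y. integrable M (\<lambda>\<omega>. (U y \<omega>)\<^sup>2)" and Uv: "\<And>y. expectation (\<lambda>\<omega>. (U y \<omega>)\<^sup>2) \<le> v y"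
    and Wv: "integrable M (\<lambda>\<omega>. W \<omega> * v (Y \<omega>))"
  shows "integrable M (\<lambda>\<omega>. W \<omega> * (U (Y \<omega>) \<omega>)\<^sup>2)"
    and "expectation (\<lambda>\<omega>. W \<omega> * (U (Y \<omega>) \<omega>)\<^sup>2) \<le> expectation (\<lambda>\<omega>. W \<omega> * v (Y \<omega>))"
proof -
  note [measurable] = Wm Ym Um measurable_from_subalg[OF sub(1) Wm] measurable_from_subalg[OF sub(1) Ym]
     measurable_from_subalg[OF sub(2) Um]
  have v0: "0 \<le> v y" for y by (rule order_trans[OF Bochner_Integration.integral_nonneg Uv]) simp
  define Z where "Z y \<omega> = indicator {y} (Y \<omega>) * W \<omega>" for y \<omega>
  have Z0: "0 \<le> Z y \<omega>" for y \<omega> using W0 by (simp add: Z_def)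
  have Zm: "Z y \<in> borel_measurable F" for y
    unfolding Z_def[abs_def] using measurable_compose[OF Ym, of "indicator {y}" borel] Wm
    by (intro borel_measurable_times) auto
  have [measurable]: "Z y \<in> borel_measurable M" for y by (rule measurable_from_subalg[OF sub(1) Zm])
  have Zi: "integrable M (Z y)" for y
    by (rule Bochner_Integration.integrable_bound[OF W])
       (auto simp: Z_def[abs_def] indicator_def)
  have part: "(\<Sum>y. ennreal (Z y \<omega> * f y)) = ennreal (W \<omega> * f (Y \<omega>))" for \<omega> and f :: "nat \<Rightarrow> real"
  proof -
    have "(\<Sum>y. ennreal (Z y \<omega> * f y)) = (\<Sum>y\<in>{Y \<omega>}. ennreal (Z y \<omega> * f y))"
      by (intro suminf_finite) (auto simp: Z_def)
    then show ?thesis by (simp add: Z_def)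
  qed
  have slice: "(\<integral>\<^sup>+\<omega>. ennreal (Z y \<omega> * (U y \<omega>)\<^sup>2) \<partial>M) \<le> (\<integral>\<^sup>+\<omega>. ennreal (Z y \<omega> * v y) \<partial>M)" for y
  proof -
    have iv: "indep_var borel (Z y) borel (\<lambda>\<omega>. (U y \<omega>)\<^sup>2)"
      by (intro indep_var_of_indep_set[OF sub ind Zm]) measurable
    have "(\<integral>\<^sup>+\<omega>. ennreal (Z y \<omega> * (U y \<omega>)\<^sup>2) \<partial>M) = ennreal (expectation (\<lambda>\<omega>. Z y \<omega> * (U y \<omega>)\<^sup>2))"
      using indep_var_integrable[OF iv Zi U] Z0 by (intro nn_integral_eq_integral) auto
    also have "\<dots> = ennreal (expectation (Z y) * expectation (\<lambda>\<omega>. (U y \<omega>)\<^sup>2))"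
      using indep_var_lebesgue_integral[OF iv Zi U] by simp
    also have "\<dots> \<le> ennreal (expectation (Z y) * v y)"
      using Z0 Uv by (intro ennreal_leI mult_left_mono Bochner_Integration.integral_nonneg) auto
    also have "\<dots> = ennreal (expectation (\<lambda>\<omega>. Z y \<omega> * v y))" by simp
    also have "\<dots> = (\<integral>\<^sup>+\<omega>. ennreal (Z y \<omega> * v y) \<partial>M)"
      using Zi Z0 v0 by (intro nn_integral_eq_integral[symmetric]) auto
    finally show ?thesis .
  qed
  have "(\<integral>\<^sup>+\<omega>. ennreal (W \<omega> * (U (Y \<omega>) \<omega>)\<^sup>2) \<partial>M) = (\<integral>\<^sup>+\<omega>. (\<Sum>y. ennreal (Z y \<omega> * (U y \<omega>)\<^sup>2)) \<partial>M)"
    by (subst part[of _ "\<lambda>y. (U y _)\<^sup>2"]) (rule refl)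
  also have "\<dots> = (\<Sum>y. \<integral>\<^sup>+\<omega>. ennreal (Z y \<omega> * (U y \<omega>)\<^sup>2) \<partial>M)"
    by (intro nn_integral_suminf) measurable
  also have "\<dots> \<le> (\<Sum>y. \<integral>\<^sup>+\<omega>. ennreal (Z y \<omega> * v y) \<partial>M)"
    by (intro suminf_le slice) auto
  also have "\<dots> = (\<integral>\<^sup>+\<omega>. (\<Sum>y. ennreal (Z y \<omega> * v y)) \<partial>M)"
    by (intro nn_integral_suminf[symmetric]) measurable
  also have "\<dots> = (\<integral>\<^sup>+\<omega>. ennreal (W \<omega> * v (Y \<omega>)) \<partial>M)" using part by simp
  also have "\<dots> = ennreal (expectation (\<lambda>\<omega>. W \<omega> * v (Y \<omega>)))"
    using W0 v0 by (intro nn_integral_eq_integral Wv) auto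
  finally have le: "(\<integral>\<^sup>+\<omega>. ennreal (W \<omega> * (U (Y \<omega>) \<omega>)\<^sup>2) \<partial>M) \<le> ennreal (expectation (\<lambda>\<omega>. W \<omega> * v (Y \<omega>)))" .
  have [measurable]: "(\<lambda>\<omega>. U (Y \<omega>) \<omega>) \<in> borel_measurable M"
    by (rule measurable_compose_countable[where g=Y and f=U]) measurable
  show i: "integrable M (\<lambda>\<omega>. W \<omega> * (U (Y \<omega>) \<omega>)\<^sup>2)"
    using le W0 by (intro integrableI_nonneg) (auto simp: less_top[symmetric] top_unique)
  have "0 \<le> expectation (\<lambda>\<omega>. W \<omega> * v (Y \<omega>))" using W0 v0 by (intro Bochner_Integration.integral_nonneg) auto
  then show "expectation (\<lambda>\<omega>. W \<omega> * (U (Y \<omega>) \<omega>)\<^sup>2) \<le> expectation (\<lambda>\<omega>. W \<omega> * v (Y \<omega>))"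
    using le W0 nn_integral_eq_integral[OF i] by (simp add: ennreal_le_iff)
qed

section \<open>The self-normalized strong law\<close>

text \<open>Discrete form of comparing with the integral of \<open>x\<close> to the power -3/2: one
  factor \<open>sqrt b\<close> is at most \<open>sqrt (a + b)\<close>, and the remaining quotient is
  bounded through the square roots \<open>p\<close> and \<open>q\<close> of the old and new partial
  sums.\<close>

lemma inverse_sqrt_telescope:
  fixes a b :: real
  assumes "0 < a" "1 \<le> b"
  shows "b * sqrt b / (a + b)\<^sup>2 \<le> 2 * (1 / sqrt a - 1 / sqrt (a + b))"
proof -
  define p q where "p = sqrt a" and "q = sqrt (a + b)"
  have pq: "0 < p" "p < q" "sqrt b \<le> q" using assms by (auto simp: p_def q_def)
  have sq: "a = p\<^sup>2" "a + b = q\<^sup>2" "b = q\<^sup>2 - p\<^sup>2" using assms by (auto simp: p_def q_def)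
  have "b * sqrt b / (a + b)\<^sup>2 \<le> b * q / (a + b)\<^sup>2"
    using pq assms by (intro divide_right_mono mult_left_mono) auto
  also have "\<dots> = (q - p) * (q + p) / (q * q * q)"
  proof -
    have "(a + b)\<^sup>2 = q * (q * q * q)" unfolding sq(2) by (simp add: power2_eq_square)
    moreover have "b = (q - p) * (q + p)" unfolding sq(3) by (simp add: power2_eq_square algebra_simps)
    ultimately show ?thesis using pq by simp
  qed
  also have "\<dots> \<le> (q - p) * (2 * q) / (q * q * p)"
    using pq by (intro frac_le mult_left_mono mult_nonneg_nonneg mult_pos_pos) auto
  also have "\<dots> = 2 * (1 / p - 1 / q)" using pq by (simp add: field_simps)
  finally show ?thesis by (simp add: p_def q_def)
qed

text \<open>\<open>F n\<close> is the past and \<open>H n\<close> the noise of step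
  \<open>n\<close>; \<open>U n y\<close> is the increment when the state is frozen at
  \<open>y\<close>. Dividing by the running sum of the \<open>b (Y i)\<close> gives martingale
  differences with summable variances, to which the convergence lemma and Kronecker's lemma
  apply.\<close>

lemma self_normalized_slln:
  fixes U :: "nat \<Rightarrow> nat \<Rightarrow> 'a \<Rightarrow> real" and Y :: "nat \<Rightarrow> 'a \<Rightarrow> nat" and b :: "nat \<Rightarrow> real"
  assumes subF: "\<And>n. subalgebra M (F n)" and subH: "\<And>n. subalgebra M (H n)"
    and mono: "\<And>n. subalgebra (F (Suc n)) (F n)" and HF: "\<And>n. subalgebra (F (Suc n)) (H n)"
    and ind: "\<And>n. indep_set (sets (F n)) (sets (H n))"
    and Ym: "\<And>n. Y n \<in> measurable (F n) (count_space UNIV)"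
    and Um: "\<And>n y. U n y \<in> borel_measurable (H n)"
    and U0: "\<And>n y. expectation (U n y) = 0"
    and U2: "\<And>n y. integrable M (\<lambda>\<omega>. (U n y \<omega>)\<^sup>2)"
    and Uv: "\<And>n y. expectation (\<lambda>\<omega>. (U n y \<omega>)\<^sup>2) \<le> C * (b y * sqrt (b y))"
    and b: "\<And>y. 1 \<le> b y"
  shows "AE \<omega> in M. (\<lambda>n. (\<Sum>k<n. U k (Y k \<omega>) \<omega>) / (\<Sum>k<n. b (Y k \<omega>))) \<longlonglongrightarrow> 0"
proof -
  \<comment> \<open>The sum includes the index \<open>n\<close>: the state \<open>Y n\<close> is
    already known before the noise of step \<open>n\<close>, so the normalizer is predictable and
    matches the one in Kronecker's lemma.\<close>
  define S where "S n \<omega> = (\<Sum>k\<le>n. b (Y k \<omega>))" for n \<omega>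
  define W where "W n \<omega> = 1 / S n \<omega>" for n \<omega>
  define X where "X n \<omega> = U n (Y n \<omega>) \<omega> / S n \<omega>" for n \<omega>
  have "0 \<le> C * (b 0 * sqrt (b 0))"
    by (rule order_trans[OF Bochner_Integration.integral_nonneg Uv]) simp
  moreover have "0 < b 0 * sqrt (b 0)" using b[of 0] by simp
  ultimately have C0: "0 \<le> C" by (simp add: zero_le_mult_iff)
  note mono' = subalgebra_chain[of F, OF mono]
  have Sge: "1 \<le> S n \<omega>" for n \<omega>
  proof -
    have "b (Y 0 \<omega>) \<le> S n \<omega>" unfolding S_def using b order_trans[OF zero_le_one b]
      by (intro member_le_sum) auto
    then show ?thesis using b[of "Y 0 \<omega>"] by linarith
  qed
  have bS: "b (Y n \<omega>) \<le> S n \<omega>" for n \<omega>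
    unfolding S_def using order_trans[OF zero_le_one b] by (intro member_le_sum) auto
  have bY: "(\<lambda>\<omega>. f (Y k \<omega>)) \<in> borel_measurable (F n)" if "k \<le> n" for k n and f :: "nat \<Rightarrow> real"
    using measurable_compose[OF measurable_from_subalg[OF mono'[OF that] Ym], of f borel] by simp
  have Sm: "S n \<in> borel_measurable (F n)" for n
    unfolding S_def[abs_def] by (intro borel_measurable_sum bY) auto
  have Wm: "W n \<in> borel_measurable (F n)" for n
    unfolding W_def[abs_def] using Sm[of n] by measurable
  have UYm: "(\<lambda>\<omega>. U n (Y n \<omega>) \<omega>) \<in> borel_measurable (F (Suc n))" for n
  proof -
    have [measurable]: "U n y \<in> borel_measurable (F (Suc n))" for y
      by (rule measurable_from_subalg[OF HF Um])
    have [measurable]: "Y n \<in> measurable (F (Suc n)) (count_space UNIV)"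
      by (rule measurable_from_subalg[OF mono Ym])
    show ?thesis by (rule measurable_compose_countable[where g="Y n" and f="U n"]) measurable
  qed
  have Xm: "X n \<in> borel_measurable (F (Suc n))" for n
    using UYm[of n] measurable_from_subalg[OF mono Sm[of n]] unfolding X_def[abs_def] by measurable
  \<comment> \<open>\<open>g n\<close> dominates the conditional second moment of
    \<open>X n\<close>. It is bounded by \<open>C\<close> because
    \<open>sqrt b \<le> b \<le> S n\<close> whenever \<open>b\<close> is the current weight.\<close>
  define g where "g n \<omega> = (W n \<omega>)\<^sup>2 * (C * (b (Y n \<omega>) * sqrt (b (Y n \<omega>))))" for n \<omega>
  have gm: "g n \<in> borel_measurable M" for n
    unfolding g_def[abs_def]
  proof -
    have "(\<lambda>\<omega>. C * (b (Y n \<omega>) * sqrt (b (Y n \<omega>)))) \<in> borel_measurable (F n)"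
      by (rule bY) simp
    from measurable_from_subalg[OF subF this]
    show "(\<lambda>\<omega>. (W n \<omega>)\<^sup>2 * (C * (b (Y n \<omega>) * sqrt (b (Y n \<omega>))))) \<in> borel_measurable M"
      by (rule borel_measurable_times[OF borel_measurable_power[OF measurable_from_subalg[OF subF Wm]]])
  qed
  have geq: "g n \<omega> = C * (b (Y n \<omega>) * sqrt (b (Y n \<omega>)) / (S n \<omega>)\<^sup>2)" for n \<omega>
    by (simp add: g_def W_def power_divide)
  have g0: "0 \<le> g n \<omega>" for n \<omega> unfolding geq using C0 order_trans[OF zero_le_one b] by simp
  have gC: "g n \<omega> \<le> C" for n \<omega>
  proof -
    have "sqrt (b (Y n \<omega>)) \<le> b (Y n \<omega>)" using b[of "Y n \<omega>"]
      by (intro real_le_lsqrt) (auto simp: power2_eq_square)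
    then have "b (Y n \<omega>) * sqrt (b (Y n \<omega>)) \<le> S n \<omega> * S n \<omega>"
      using bS[of n \<omega>] b[of "Y n \<omega>"] by (intro mult_mono) auto
    then have "b (Y n \<omega>) * sqrt (b (Y n \<omega>)) / (S n \<omega>)\<^sup>2 \<le> 1"
      using Sge[of n \<omega>] by (simp add: power2_eq_square)
    from mult_left_mono[OF this C0] show ?thesis by (simp only: geq mult_1_right)
  qed
  have gi: "integrable M (g n)" for n
  proof (rule integrable_const_bound[where B=C])
    show "AE \<omega> in M. norm (g n \<omega>) \<le> C" using g0[of n] gC[of n] by (intro AE_I2) simp
  qed (rule gm)
  have W2: "integrable M (\<lambda>\<omega>. (W n \<omega>)\<^sup>2)" for n
  proof (rule integrable_const_bound[where B=1])
    have "norm ((W n \<omega>)\<^sup>2) \<le> 1" for \<omega>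
      using one_le_power[OF Sge[of n \<omega>], of 2] Sge[of n \<omega>]
      by (simp add: W_def power_divide divide_le_eq_1)
    then show "AE \<omega> in M. norm ((W n \<omega>)\<^sup>2) \<le> 1" by simp
  qed (rule borel_measurable_power[OF measurable_from_subalg[OF subF Wm]])
  have Xsq: "(X n \<omega>)\<^sup>2 = (W n \<omega>)\<^sup>2 * (U n (Y n \<omega>) \<omega>)\<^sup>2" for n \<omega>
    by (simp add: X_def W_def power_divide)
  have X2: "integrable M (\<lambda>\<omega>. (X n \<omega>)\<^sup>2)"
      "expectation (\<lambda>\<omega>. (X n \<omega>)\<^sup>2) \<le> expectation (g n)" for n
  proof -
    have m: "(\<lambda>\<omega>. (W n \<omega>)\<^sup>2) \<in> borel_measurable (F n)"
      by (rule borel_measurable_power[OF Wm])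
    have gi': "integrable M (\<lambda>\<omega>. (W n \<omega>)\<^sup>2 * (C * (b (Y n \<omega>) * sqrt (b (Y n \<omega>)))))"
      using gi[of n] unfolding g_def[abs_def] .
    note fr = frozen_square_integrable[OF subF subH ind m Ym Um zero_le_power2 W2 U2 Uv gi']
    show "integrable M (\<lambda>\<omega>. (X n \<omega>)\<^sup>2)" unfolding Xsq by (rule fr)
    show "expectation (\<lambda>\<omega>. (X n \<omega>)\<^sup>2) \<le> expectation (g n)"
      unfolding Xsq g_def[abs_def] by (rule fr)
  qed
  have orth: "expectation (\<lambda>\<omega>. V \<omega> * X n \<omega>) = 0"
    if Vm: "V \<in> borel_measurable (F n)" and V2: "integrable M (\<lambda>\<omega>. (V \<omega>)\<^sup>2)" for V n
  proof -
    note M = measurable_from_subalg[OF subF Vm] measurable_from_subalg[OF subF Wm]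
      measurable_from_subalg[OF subF Xm]
    have Vi: "integrable M V" by (rule square_integrable_imp_integrable[OF M(1) V2])
    have eq: "V \<omega> * X n \<omega> = (V \<omega> * W n \<omega>) * U n (Y n \<omega>) \<omega>" for \<omega> by (simp add: X_def W_def)
    have VX: "integrable M (\<lambda>\<omega>. V \<omega> * X n \<omega>)" by (rule integrable_mult_of_squares[OF M(1) M(3) V2 X2(1)])
    have VW: "integrable M (\<lambda>\<omega>. V \<omega> * W n \<omega>)" by (rule integrable_mult_of_squares[OF M(1) M(2) V2 W2])
    have Ui: "integrable M (U n y)" for y
      by (rule square_integrable_imp_integrable[OF measurable_from_subalg[OF subH Um] U2])
    show ?thesis unfolding eq
      by (rule expectation_frozen_eq_0[OF subF subH ind borel_measurable_times[OF Vm Wm] Ym Um VW Ui U0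
            VX[unfolded eq]])
  qed
  have summ: "summable (\<lambda>n. expectation (\<lambda>\<omega>. (X n \<omega>)\<^sup>2))"
  \<comment> \<open>The first term is split off because the telescoping estimate needs a positive
    previous partial sum \<open>S k\<close>.\<close>
  proof (subst summable_Suc_iff[symmetric], rule summableI_nonneg_bounded)
    fix n :: nat
    show "0 \<le> expectation (\<lambda>\<omega>. (X (Suc n) \<omega>)\<^sup>2)" by simp
    \<comment> \<open>This bound is pathwise and uniform in \<open>n\<close>, whatever states are
      visited; its expectation bounds the partial sums of the variances.\<close>
    have pt: "(\<Sum>k<n. g (Suc k) \<omega>) \<le> 2 * C" for \<omega>
    proof -
      have "(\<Sum>k<n. g (Suc k) \<omega>) \<le> (\<Sum>k<n. 2 * C * (1 / sqrt (S k \<omega>) - 1 / sqrt (S (Suc k) \<omega>)))"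
      proof (rule sum_mono)
        fix k
        have "S (Suc k) \<omega> = S k \<omega> + b (Y (Suc k) \<omega>)" by (simp add: S_def)
        then show "g (Suc k) \<omega> \<le> 2 * C * (1 / sqrt (S k \<omega>) - 1 / sqrt (S (Suc k) \<omega>))"
          using mult_left_mono[OF inverse_sqrt_telescope[of "S k \<omega>" "b (Y (Suc k) \<omega>)"] C0] Sge[of k \<omega>] b
          by (simp add: geq mult_ac)
      qed
      also have "\<dots> = 2 * C * (1 / sqrt (S 0 \<omega>) - 1 / sqrt (S n \<omega>))"
        unfolding sum_distrib_left[symmetric] sum_lessThan_telescope'[of "\<lambda>k. 1 / sqrt (S k \<omega>)"] ..
      also have "\<dots> \<le> 2 * C * 1"
      proof (intro mult_left_mono)
        have "1 / sqrt (S 0 \<omega>) \<le> 1" "0 \<le> 1 / sqrt (S n \<omega>)" using Sge[of 0 \<omega>] Sge[of n \<omega>] by auto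
        then show "1 / sqrt (S 0 \<omega>) - 1 / sqrt (S n \<omega>) \<le> 1" by linarith
      qed (use C0 in auto)
      finally show ?thesis by simp
    qed
    have "(\<Sum>k<n. expectation (\<lambda>\<omega>. (X (Suc k) \<omega>)\<^sup>2)) \<le> (\<Sum>k<n. expectation (g (Suc k)))"
      by (intro sum_mono X2)
    also have "\<dots> = expectation (\<lambda>\<omega>. \<Sum>k<n. g (Suc k) \<omega>)" using gi by simp
    also have "\<dots> \<le> expectation (\<lambda>\<omega>. 2 * C)"
      using gi pt by (intro integral_mono) auto
    finally show "(\<Sum>k<n. expectation (\<lambda>\<omega>. (X (Suc k) \<omega>)\<^sup>2)) \<le> 2 * C" by (simp add: prob_space)
  qed
  have "AE \<omega> in M. summable (\<lambda>n. X n \<omega>)"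
    by (rule orthogonal_increments_summable[OF subF mono Xm X2(1) orth summ])
  then show ?thesis
  proof eventually_elim
    case (elim \<omega>)
    then show ?case
      using b by (intro kronecker) (auto simp: X_def S_def)
  qed
qed

end

subsection \<open>Least squares\<close>

lemma sumS_shift:
  assumes "1 \<le> s" "s \<le> n"
  shows "sumS s n f = (\<Sum>k<n. f (Suc k)) - f s"
proof -
  have "sumS s n f = sum f {1..n} - f s"
    unfolding sumS_def using assms by (subst sum_diff1) auto
  also have "sum f {1..n} = (\<Sum>k<n. f (Suc k))"
    by (simp add: sum.atLeast1_atMost_eq)
  finally show ?thesis .
qed

lemma sumS_const: "1 \<le> s \<Longrightarrow> s \<le> n \<Longrightarrow> sumS s n (\<lambda>_. c) = (real n - 1) * c"
  by (simp add: sumS_shift algebra_simps)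

lemma sumS_add: "sumS s n (\<lambda>k. f k + g k) = sumS s n f + sumS s n g"
  by (simp add: sumS_def sum.distrib)

lemma sumS_scale: "sumS s n (\<lambda>k. c * f k) = c * sumS s n f"
  by (simp add: sumS_def sum_distrib_left)

text \<open>The parameter \<open>t\<close> occurs only in the last square and can always make it
  zero. What remains is linear regression without the observation at \<open>s\<close>:
  \<open>a0\<close> and \<open>m0\<close> solve the normal equations \<open>ne1\<close> and
  \<open>ne2\<close>, whose determinant is \<open>Dn\<close>.\<close>

lemma Qn_minimizer_unique:
  assumes s: "1 \<le> s" "s \<le> n" and D: "0 < Dn s n y"
  shows "{p. \<forall>q. Qn s n y p \<le> Qn s n y q} = {(alpha_hat s n y, mu_hat s n y, theta_hat s n y)}"
proof -
  define N where "N = real n - 1"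
  define S1 where "S1 = sumS s n (\<lambda>k. y (k - 1))"
  define S2 where "S2 = sumS s n (\<lambda>k. (y (k - 1))\<^sup>2)"
  define T where "T = sumS s n y"
  define P where "P = sumS s n (\<lambda>k. y (k - 1) * y k)"
  define T2 where "T2 = sumS s n (\<lambda>k. (y k)\<^sup>2)"
  define a0 m0 where "a0 = alpha_hat s n y" and "m0 = mu_hat s n y"
  have Deq: "Dn s n y = N * S2 - S1\<^sup>2" by (simp add: Dn_def N_def S1_def S2_def)
  \<comment> \<open>For \<open>N = 0\<close> the determinant would reduce to minus the square of
    \<open>S1\<close>.\<close>
  have N0: "0 < N"
  proof (rule ccontr)
    assume "\<not> 0 < N"
    moreover have "0 \<le> N" using s by (simp add: N_def)
    ultimately show False using D Deq by simp
  qed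
  have a0: "a0 * (N * S2 - S1\<^sup>2) = N * P - T * S1"
  proof -
    have "a0 = (N * P - T * S1) / Dn s n y"
      unfolding a0_def alpha_hat_def N_def P_def T_def S1_def ..
    then show ?thesis using D by (simp add: Deq)
  qed
  have m0: "m0 * (N * S2 - S1\<^sup>2) = S2 * T - S1 * P"
  proof -
    have "m0 = (S2 * T - S1 * P) / Dn s n y"
      unfolding m0_def mu_hat_def S2_def P_def T_def S1_def ..
    then show ?thesis using D by (simp add: Deq)
  qed
  have D': "N * S2 - S1\<^sup>2 \<noteq> 0" using D Deq by simp
  have ne1: "a0 * S2 + m0 * S1 = P"
  proof -
    have "(a0 * S2 + m0 * S1) * (N * S2 - S1\<^sup>2) = (a0 * (N * S2 - S1\<^sup>2)) * S2 + (m0 * (N * S2 - S1\<^sup>2)) * S1"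
      by (simp add: algebra_simps)
    also have "\<dots> = P * (N * S2 - S1\<^sup>2)" unfolding a0 m0 by (simp add: algebra_simps power2_eq_square)
    finally show ?thesis using D' by simp
  qed
  have ne2: "a0 * S1 + m0 * N = T"
  proof -
    have "(a0 * S1 + m0 * N) * (N * S2 - S1\<^sup>2) = (a0 * (N * S2 - S1\<^sup>2)) * S1 + (m0 * (N * S2 - S1\<^sup>2)) * N"
      by (simp add: algebra_simps)
    also have "\<dots> = T * (N * S2 - S1\<^sup>2)" unfolding a0 m0 by (simp add: algebra_simps power2_eq_square)
    finally show ?thesis using D' by simp
  qed
  \<comment> \<open>The Gram form of the regressors. Multiplied by \<open>N\<close> it becomes a
    square plus a positive multiple of the square of \<open>a\<close>, hence it is positive
    definite.\<close>
  define quad where "quad a m = a\<^sup>2 * S2 + 2 * a * m * S1 + m\<^sup>2 * N" for a m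
  have quad: "N * quad a m = (N * m + S1 * a)\<^sup>2 + (N * S2 - S1\<^sup>2) * a\<^sup>2" for a m
    by (simp add: quad_def power2_eq_square algebra_simps)
  have Dp: "0 < N * S2 - S1\<^sup>2" using D Deq by simp
  have quad0: "0 \<le> quad a m" for a m
  proof -
    have "0 \<le> N * quad a m" unfolding quad using Dp by simp
    then show ?thesis using N0 by (simp add: zero_le_mult_iff)
  qed
  have quad_eq0: "a = 0 \<and> m = 0" if "quad a m = 0" for a m
  proof -
    have "(N * m + S1 * a)\<^sup>2 + (N * S2 - S1\<^sup>2) * a\<^sup>2 = 0" using quad[of a m] that by simp
    moreover have "0 \<le> (N * m + S1 * a)\<^sup>2" "0 \<le> (N * S2 - S1\<^sup>2) * a\<^sup>2" using Dp by auto
    ultimately have "(N * m + S1 * a)\<^sup>2 = 0" "(N * S2 - S1\<^sup>2) * a\<^sup>2 = 0" by linarith+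
    then show ?thesis using Dp N0 by auto
  qed
  \<comment> \<open>The residual sum of squares at the solution of the normal equations, which is
    the minimal value.\<close>
  define c where "c = T2 - a0 * P - m0 * T"
  have Q: "Qn s n y (a, m, t) = c + quad (a - a0) (m - m0) + (y s - a * y (s - 1) - m - t)\<^sup>2" for a m t
  proof -
    have "(\<Sum>k\<in>{1..n} - {s}. (y k - a * y (k - 1) - m)\<^sup>2) =
        sumS s n (\<lambda>k. (y k)\<^sup>2 + (- 2 * a) * (y (k - 1) * y k) + (- 2 * m) * y k
           + a\<^sup>2 * (y (k - 1))\<^sup>2 + (2 * a * m) * y (k - 1) + m\<^sup>2)"
      unfolding sumS_def by (intro sum.cong) (auto simp: power2_eq_square algebra_simps)
    also have "\<dots> = T2 + (- 2 * a) * P + (- 2 * m) * T + a\<^sup>2 * S2 + (2 * a * m) * S1 + N * m\<^sup>2"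
      unfolding sumS_add sumS_scale sumS_const[OF s] T2_def P_def T_def S2_def S1_def N_def ..
    also have "\<dots> = c + quad (a - a0) (m - m0)"
      unfolding c_def quad_def ne1[symmetric] ne2[symmetric]
      by (simp add: power2_eq_square algebra_simps)
    finally show ?thesis by (simp add: Qn_def)
  qed
  have best: "Qn s n y (a0, m0, theta_hat s n y) = c"
    unfolding Q by (simp add: theta_hat_def a0_def m0_def quad_def)
  have ge: "c \<le> Qn s n y q" for q
    using quad0 by (cases q) (simp add: Q)
  have uniq: "p = (a0, m0, theta_hat s n y)" if "Qn s n y p \<le> c" for p
  proof -
    obtain a m t where p: "p = (a, m, t)" by (cases p) auto
    have "quad (a - a0) (m - m0) + (y s - a * y (s - 1) - m - t)\<^sup>2 \<le> 0"
      using that by (simp add: p Q)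
    moreover have "0 \<le> quad (a - a0) (m - m0)" "0 \<le> (y s - a * y (s - 1) - m - t)\<^sup>2"
      using quad0 by auto
    ultimately have "quad (a - a0) (m - m0) = 0" "(y s - a * y (s - 1) - m - t)\<^sup>2 = 0" by linarith+
    with quad_eq0[of "a - a0" "m - m0"] show ?thesis
      by (simp add: p theta_hat_def a0_def m0_def)
  qed
  show ?thesis unfolding a0_def[symmetric] m0_def[symmetric]
  proof (intro equalityI subsetI)
    fix p assume "p \<in> {p. \<forall>q. Qn s n y p \<le> Qn s n y q}"
    then have "Qn s n y p \<le> c" using best by (metis mem_Collect_eq)
    then show "p \<in> {(a0, m0, theta_hat s n y)}" using uniq by simp
  next
    fix p assume "p \<in> {(a0, m0, theta_hat s n y)}"
    then show "p \<in> {p. \<forall>q. Qn s n y p \<le> Qn s n y q}" using best ge by simp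
  qed
qed

section \<open>Perturbed linear recursions and convergence of averages\<close>

text \<open>The slope \<open>e / (1 - \<rho>)\<close> solves \<open>c = \<rho> * c + e\<close>, so
  the linear bound reproduces itself under one step.\<close>

lemma contraction_linear_bound:
  fixes x :: "nat \<Rightarrow> real"
  assumes rho: "0 \<le> \<rho>" "\<rho> < 1" and e: "0 \<le> e"
    and step: "\<And>n. N \<le> n \<Longrightarrow> \<bar>x (Suc n)\<bar> \<le> \<rho> * \<bar>x n\<bar> + e * real n"
    and n: "N \<le> n"
  shows "\<bar>x n\<bar> \<le> \<bar>x N\<bar> + e / (1 - \<rho>) * real n"
  using n
proof (induction rule: dec_induct)
  case base then show ?case using rho e by simp
next
  case (step n)
  have "\<bar>x (Suc n)\<bar> \<le> \<rho> * (\<bar>x N\<bar> + e / (1 - \<rho>) * real n) + e * real n"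
    using assms(4)[of n] step rho mult_left_mono[OF step.IH rho(1)] by linarith
  also have "\<dots> = \<rho> * \<bar>x N\<bar> + (\<rho> * (e / (1 - \<rho>)) + e) * real n" by (simp add: algebra_simps)
  also have "\<rho> * (e / (1 - \<rho>)) + e = e / (1 - \<rho>)" using rho by (simp add: field_simps)
  also have "\<rho> * \<bar>x N\<bar> \<le> \<bar>x N\<bar>" using rho by (simp add: mult_left_le_one_le)
  also have "e / (1 - \<rho>) * real n \<le> e / (1 - \<rho>) * real (Suc n)"
    using rho e by (intro mult_left_mono) auto
  finally show ?case by simp
qed

text \<open>Summing the recursion gives a contraction for \<open>x n = S n - m * n\<close>, driven
  by the bounded \<open>c n\<close> and by \<open>R n\<close>. Only \<open>R n = o(n + S n)\<close>
  is known, with \<open>S n\<close> not yet controlled; as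
  \<open>S n \<le> \<bar>x n\<bar> + \<bar>m\<bar> * n\<close>, the unknown part is absorbed into
  the contraction factor.\<close>

lemma average_limit:
  fixes y d :: "nat \<Rightarrow> real"
  assumes alpha: "0 \<le> \<alpha>" "\<alpha> < 1" and y0: "\<And>k. 0 \<le> y k"
    and rec: "\<And>k. y (Suc k) = \<alpha> * y k + \<mu> + d k + (if Suc k = s then \<theta> else 0)"
    and d: "(\<lambda>n. (\<Sum>k<n. d k) / (\<Sum>k<n. 1 + y k)) \<longlonglongrightarrow> 0"
  shows "(\<lambda>n. (\<Sum>k<n. y k) / n) \<longlonglongrightarrow> \<mu> / (1 - \<alpha>)"
proof -
  define m where "m = \<mu> / (1 - \<alpha>)"
  have m: "m = \<alpha> * m + \<mu>" using alpha by (simp add: m_def field_simps)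
  define S where "S n = (\<Sum>k<n. y k)" for n
  define R where "R n = (\<Sum>k<n. d k)" for n
  define x where "x n = S n - m * n" for n
  define c where "c n = y 0 - m + (\<Sum>k<n. if Suc k = s then \<theta> else 0)" for n
  define K where "K = \<bar>y 0 - m\<bar> + \<bar>\<theta>\<bar>"
  have S0: "0 \<le> S n" for n unfolding S_def using y0 by (intro sum_nonneg) auto
  have cK: "\<bar>c n\<bar> \<le> K" for n
  proof -
    \<comment> \<open>The case \<open>s = 0\<close> is separated because \<open>s - 1\<close> is
      then 0 and would wrongly select \<open>k = 0\<close>.\<close>
    have "(\<Sum>k<n. if Suc k = s then \<theta> else 0) = (\<Sum>k<n. if k = s - 1 then (if s = 0 then 0 else \<theta>) else 0)"
      by (intro sum.cong) auto
    then have "\<bar>\<Sum>k<n. if Suc k = s then \<theta> else 0\<bar> \<le> \<bar>\<theta>\<bar>" by simp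
    then show ?thesis unfolding c_def K_def by linarith
  qed
  have xS: "x (Suc n) = \<alpha> * x n + c n + R n" for n
  proof -
    have "S (Suc n) = y 0 + (\<Sum>k<n. y (Suc k))" unfolding S_def by (rule sum.lessThan_Suc_shift)
    also have "(\<Sum>k<n. y (Suc k)) = \<alpha> * S n + \<mu> * n + R n + (\<Sum>k<n. if Suc k = s then \<theta> else 0)"
      unfolding rec S_def R_def by (simp add: sum.distrib sum_distrib_left mult.commute)
    finally show ?thesis using m unfolding x_def c_def
      by (simp add: algebra_simps) (simp add: distrib_right[symmetric] distrib_left[symmetric] flip: mult.assoc)
  qed
  have "(\<lambda>n. x n / n) \<longlonglongrightarrow> 0"
  proof (rule LIMSEQ_I)
    fix r :: real assume r: "0 < r"
    \<comment> \<open>The first entry keeps the contraction factor \<open>\<alpha> + e\<close> at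
      most \<open>(1 + \<alpha>) / 2\<close>; the second makes the resulting growth rate at most
      \<open>r / 2\<close>, the other half of \<open>r\<close> being left for the constant
      \<open>\<bar>x N\<bar>\<close>.\<close>
    define e where "e = min ((1 - \<alpha>) / 2) (r * (1 - \<alpha>) / (4 * (2 + \<bar>m\<bar>)))"
    have e0: "0 < e" using alpha r by (auto simp: e_def intro!: divide_pos_pos mult_pos_pos)
    have e1: "\<alpha> + e \<le> (1 + \<alpha>) / 2" by (simp add: e_def min_def field_simps)
    have e2: "e * (2 + \<bar>m\<bar>) \<le> r * (1 - \<alpha>) / 4"
    proof -
      have "e * (2 + \<bar>m\<bar>) \<le> (r * (1 - \<alpha>) / (4 * (2 + \<bar>m\<bar>))) * (2 + \<bar>m\<bar>)"
        by (intro mult_right_mono) (auto simp: e_def)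
      also have "\<dots> = r * (1 - \<alpha>) / 4" by (simp add: add_pos_nonneg field_simps)
      finally show ?thesis .
    qed
    obtain N1 where N1: "\<And>n. n \<ge> N1 \<Longrightarrow> \<bar>R n / (\<Sum>k<n. 1 + y k)\<bar> < e"
      using LIMSEQ_D[OF d e0] by (auto simp: R_def)
    obtain N2 where N2: "K / e < real N2" using reals_Archimedean2 by blast
    define N where "N = max (Suc N1) N2"
    have step: "\<bar>x (Suc n)\<bar> \<le> (\<alpha> + e) * \<bar>x n\<bar> + (e * (2 + \<bar>m\<bar>)) * real n" if n: "N \<le> n" for n
    proof -
      have T: "(\<Sum>k<n. 1 + y k) = n + S n" by (simp add: S_def sum.distrib)
      have pos: "0 < n + S n" using n S0[of n] by (auto simp: N_def intro: add_pos_nonneg)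
      have "\<bar>R n\<bar> \<le> e * (n + S n)"
        using N1[of n] n pos unfolding T N_def by (simp add: abs_divide pos_divide_less_eq)
      also have "\<dots> \<le> e * (n + (\<bar>x n\<bar> + \<bar>m\<bar> * n))"
      proof (intro mult_left_mono add_left_mono)
        have "m * n \<le> \<bar>m\<bar> * n" by (intro mult_right_mono) auto
        then show "S n \<le> \<bar>x n\<bar> + \<bar>m\<bar> * n" unfolding x_def by linarith
      qed (use e0 in auto)
      finally have R: "\<bar>R n\<bar> \<le> e * (n + (\<bar>x n\<bar> + \<bar>m\<bar> * n))" .
      have "K < e * N2" using N2 e0 by (simp add: field_simps)
      also have "\<dots> \<le> e * n" using n e0 by (intro mult_left_mono) (auto simp: N_def)
      finally have "\<bar>c n\<bar> \<le> e * n" using cK[of n] by linarith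
      moreover have "\<bar>x (Suc n)\<bar> \<le> \<alpha> * \<bar>x n\<bar> + \<bar>c n\<bar> + \<bar>R n\<bar>"
        unfolding xS using alpha abs_triangle_ineq[of "\<alpha> * x n + c n" "R n"] abs_triangle_ineq[of "\<alpha> * x n" "c n"]
        by (simp add: abs_mult)
      ultimately show ?thesis using R by (simp add: algebra_simps)
    qed
    have bound: "\<bar>x n\<bar> \<le> \<bar>x N\<bar> + r / 2 * n" if n: "N \<le> n" for n
    proof -
      have "\<bar>x n\<bar> \<le> \<bar>x N\<bar> + (e * (2 + \<bar>m\<bar>)) / (1 - (\<alpha> + e)) * real n"
        by (rule contraction_linear_bound[OF _ _ _ step n]) (use alpha e0 e1 in auto)
      moreover have "(e * (2 + \<bar>m\<bar>)) / (1 - (\<alpha> + e)) \<le> (r * (1 - \<alpha>) / 4) / ((1 - \<alpha>) / 2)"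
        using e0 e1 e2 alpha r by (intro frac_le) (auto simp: field_simps)
      moreover have "(r * (1 - \<alpha>) / 4) / ((1 - \<alpha>) / 2) = r / 2" using alpha by (simp add: field_simps)
      ultimately show ?thesis
        using mult_right_mono[of "(e * (2 + \<bar>m\<bar>)) / (1 - (\<alpha> + e))" "r / 2" "real n"] by linarith
    qed
    obtain N3 where N3: "2 * \<bar>x N\<bar> / r < real N3" using reals_Archimedean2 by blast
    show "\<exists>no. \<forall>n\<ge>no. norm (x n / n - 0) < r"
    proof (intro exI allI impI)
      fix n assume n: "n \<ge> max (Suc N) N3"
      have "\<bar>x N\<bar> < r / 2 * N3" using N3 r by (simp add: field_simps)
      also have "\<dots> \<le> r / 2 * n" using n r by (intro mult_left_mono) auto
      finally have "\<bar>x n\<bar> < r * n" using bound[of n] n by auto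
      then show "norm (x n / n - 0) < r" using n by (simp add: abs_divide pos_divide_less_eq)
    qed
  qed
  then have "(\<lambda>n. x n / n + m) \<longlonglongrightarrow> 0 + m" by (intro tendsto_add tendsto_const)
  moreover have "\<forall>\<^sub>F n in sequentially. x n / n + m = S n / n"
    using eventually_gt_at_top[of 0] by eventually_elim (simp add: x_def field_simps)
  ultimately show ?thesis unfolding m_def[symmetric] S_def[symmetric] by (simp add: tendsto_cong)
qed

subsection \<open>Deterministic asymptotics along a path\<close>

text \<open>What a typical path has to satisfy. Intended meaning: \<open>\<psi> k\<close> is the
  first centred counting variable of step \<open>k + 1\<close>, \<open>i k\<close> indicates
  \<open>y k \<ge> 1\<close>, \<open>j k\<close> indicates a nonzero innovation at time
  \<open>k + 1\<close> and \<open>p\<close> is its probability. Then \<open>a * i k\<close> is the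
  conditional mean of \<open>(y (Suc k) - m) * \<psi> k\<close>, and \<open>ji\<close> holds because
  a nonzero innovation makes the next state positive.\<close>

locale inar_path =
  fixes y d \<psi> i j :: "nat \<Rightarrow> real" and \<alpha> \<mu> \<theta> a p :: real and s :: nat
  assumes alpha: "0 \<le> \<alpha>" "\<alpha> < 1" and a: "0 < a" and p: "0 < p"
    and y0: "\<And>k. 0 \<le> y k"
    and rec: "\<And>k. y (Suc k) = \<alpha> * y k + \<mu> + d k + (if Suc k = s then \<theta> else 0)"
    and psi: "\<And>k. \<bar>\<psi> k\<bar> \<le> 1" and i0: "\<And>k. 0 \<le> i k" and ji: "\<And>k. j k \<le> i (Suc k)"
    and sum_d: "(\<lambda>n. (\<Sum>k<n. d k) / (\<Sum>k<n. 1 + y k)) \<longlonglongrightarrow> 0"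
    and sum_yd: "(\<lambda>n. (\<Sum>k<n. y k * d k) / (\<Sum>k<n. (1 + y k)\<^sup>2)) \<longlonglongrightarrow> 0"
    and sum_psi: "(\<lambda>n. (\<Sum>k<n. (y (Suc k) - \<mu> / (1 - \<alpha>)) * \<psi> k - a * i k) / (\<Sum>k<n. (1 + y k)\<^sup>2)) \<longlonglongrightarrow> 0"
    and sum_j: "(\<lambda>n. (\<Sum>k<n. j k - p) / (\<Sum>k<n. 1 + y k)) \<longlonglongrightarrow> 0"
begin

section \<open>Variation about the stationary mean\<close>

definition "m = \<mu> / (1 - \<alpha>)"
definition "S n = (\<Sum>k<n. y k)"
definition "B n = (\<Sum>k<n. (1 + y k)\<^sup>2)"
definition "V n = (\<Sum>k<n. (y k - m)\<^sup>2)"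

lemma S_nonneg: "0 \<le> S n"
  unfolding S_def using y0 by (intro sum_nonneg) auto

lemma sum_1_y: "(\<Sum>k<n. 1 + y k) = n + S n"
  by (simp add: S_def sum.distrib)

lemma mean_limit: "(\<lambda>n. S n / n) \<longlonglongrightarrow> m"
  unfolding S_def m_def by (rule average_limit[OF alpha y0 rec sum_d])

lemma B_ge: "n + S n \<le> B n" "(\<Sum>k<n. (y k)\<^sup>2) \<le> B n"
proof -
  have "1 + y k \<le> (1 + y k)\<^sup>2" for k
    using y0[of k] by (simp add: power2_eq_square algebra_simps)
  then show "n + S n \<le> B n" unfolding sum_1_y[symmetric] B_def by (rule sum_mono)
  have "(y k)\<^sup>2 \<le> (1 + y k)\<^sup>2" for k using y0[of k] by (intro power_mono) auto
  then show "(\<Sum>k<n. (y k)\<^sup>2) \<le> B n" unfolding B_def by (rule sum_mono)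
qed

lemma B_ge_n: "real n \<le> B n"
  using B_ge(1)[of n] S_nonneg[of n] by linarith

lemma B_mono: "n \<le> n' \<Longrightarrow> B n \<le> B n'"
  unfolding B_def by (intro sum_mono2) auto

text \<open>The sum of \<open>1 + y k\<close> is comparable to \<open>n\<close>, since the averages
  of \<open>y\<close> converge.\<close>

lemma div_n_limit:
  assumes "(\<lambda>n. f n / (\<Sum>k<n. 1 + y k)) \<longlonglongrightarrow> 0"
  shows "(\<lambda>n. f n / real n) \<longlonglongrightarrow> 0"
proof -
  have "(\<lambda>n. f n / (\<Sum>k<n. 1 + y k) * (1 + S n / n)) \<longlonglongrightarrow> 0 * (1 + m)"
    by (intro tendsto_mult assms tendsto_add tendsto_const mean_limit)
  moreover have "\<forall>\<^sub>F n in sequentially. f n / (\<Sum>k<n. 1 + y k) * (1 + S n / n) = f n / n"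
    using eventually_gt_at_top[of 0]
  proof eventually_elim
    case (elim n)
    have "0 < n + S n" using elim S_nonneg[of n] by (intro add_pos_nonneg) auto
    then have "n + S n \<noteq> 0" "real n \<noteq> 0" using elim by auto
    moreover have "1 + S n / n = (n + S n) / n" using elim by (simp add: field_simps)
    ultimately show ?case unfolding sum_1_y by simp
  qed
  ultimately show ?thesis by (simp add: tendsto_cong)
qed

lemma eventually_abs_le:
  assumes "(\<lambda>n. f n / g n) \<longlonglongrightarrow> (0::real)" "0 < e" "\<And>n. 0 < n \<Longrightarrow> 0 < g n"
  shows "\<forall>\<^sub>F n in sequentially. \<bar>f n\<bar> \<le> e * g n"
proof -
  have "\<forall>\<^sub>F n in sequentially. \<bar>f n / g n\<bar> < e"
    using tendstoD[OF assms(1,2)] by simp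
  then show ?thesis using eventually_gt_at_top[of 0]
  proof eventually_elim
    case (elim n)
    then show ?case using assms(3)[of n] by (simp add: abs_divide pos_divide_less_eq)
  qed
qed

lemma B_pos: "0 < n \<Longrightarrow> 0 < B n"
  using B_ge_n[of n] by simp

text \<open>Expand \<open>(1 + y k) - (1 + m)\<close> squared. The linear term is written through
  \<open>S n - m * n\<close>, which is \<open>o(n)\<close>.\<close>

lemma V_eq: "V n = B n - 2 * (1 + m) * (S n - m * n) - (1 + m)\<^sup>2 * n"
proof -
  have "V n = (\<Sum>k<n. (1 + y k)\<^sup>2 + (- 2 * (1 + m)) * y k + ((1 + m)\<^sup>2 - 2 * (1 + m)))"
    unfolding V_def by (intro sum.cong) (auto simp: power2_eq_square algebra_simps)
  also have "\<dots> = B n + (- 2 * (1 + m)) * S n + n * ((1 + m)\<^sup>2 - 2 * (1 + m))"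
    unfolding sum.distrib sum_distrib_left[symmetric] B_def S_def by simp
  finally show ?thesis by (simp add: power2_eq_square algebra_simps)
qed

text \<open>The bound that is effective when \<open>B n\<close> is much larger than
  \<open>n\<close>; the linear term of \<open>V_eq\<close> is \<open>o(n)\<close> and
  \<open>n \<le> B n\<close>.\<close>

lemma V_lower1:
  assumes e: "0 < e"
  shows "\<forall>\<^sub>F n in sequentially. B n - (1 + m)\<^sup>2 * n - e * B n \<le> V n"
proof -
  have "(\<lambda>n. 2 * (1 + m) * (S n / n - m)) \<longlonglongrightarrow> 2 * (1 + m) * (m - m)"
    by (intro tendsto_intros mean_limit)
  moreover have "\<forall>\<^sub>F n in sequentially. 2 * (1 + m) * (S n / n - m) = (2 * (1 + m) * (S n - m * n)) / n"
    using eventually_gt_at_top[of 0] by eventually_elim (simp add: field_simps)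
  ultimately have "(\<lambda>n. (2 * (1 + m) * (S n - m * n)) / real n) \<longlonglongrightarrow> 0"
    by (simp add: tendsto_cong)
  from eventually_abs_le[OF this e] show ?thesis
  proof (rule eventually_mono)
    fix n assume "\<bar>2 * (1 + m) * (S n - m * real n)\<bar> \<le> e * real n"
    moreover have "e * real n \<le> e * B n" using e B_ge_n by (intro mult_left_mono) auto
    ultimately show "B n - (1 + m)\<^sup>2 * n - e * B n \<le> V n" unfolding V_eq by linarith
  qed simp
qed

text \<open>Completing the square against \<open>\<lambda> \<psi> k\<close>: the centred variation is at least
  \<open>2 \<lambda> \<Sum> (y (Suc k) - m) \<psi> k - \<lambda>\<^sup>2 n\<close>, and the choice \<open>\<lambda> = a p\<close> is optimal.\<close>
lemma V_lower2:
  assumes e: "0 < e"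
  shows "\<forall>\<^sub>F n in sequentially. (a * p)\<^sup>2 * n - e * B n \<le> V n"
proof -
  define l where "l = a * p"
  have l: "0 < l" using a p by (simp add: l_def)
  define G where "G n = (\<Sum>k<n. (y (Suc k) - m) * \<psi> k - a * i k)" for n
  define J where "J n = (\<Sum>k<n. j k - p)" for n
  \<comment> \<open>With these values \<open>2 * l * e1\<close> and \<open>2 * l * a * e2\<close>
    both equal \<open>e / 4\<close>; the remaining \<open>e / 2\<close> pays for the shift of
    indices.\<close>
  define e1 where "e1 = e / (8 * l)"
  define e2 where "e2 = e / (8 * l * a)"
  have "\<forall>\<^sub>F n in sequentially. \<bar>G n\<bar> \<le> e1 * B n"
    using e l sum_psi by (intro eventually_abs_le B_pos) (auto simp: G_def B_def m_def e1_def)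
  then have evG: "\<forall>\<^sub>F n in sequentially. \<bar>G (Suc n)\<bar> \<le> e1 * B (Suc n)"
    by (rule eventually_compose_filterlim) (rule filterlim_Suc)
  have evJ: "\<forall>\<^sub>F n in sequentially. \<bar>J n\<bar> \<le> e2 * n"
    using e l a div_n_limit[OF sum_j] by (intro eventually_abs_le) (auto simp: J_def e2_def)
  \<comment> \<open>Makes \<open>3 * l\<^sup>2\<close> at most half of \<open>e * B (n + 2)\<close>;
    this is the gap between \<open>l\<^sup>2 * (n + 2)\<close> and
    \<open>2 * l\<^sup>2 * n - l\<^sup>2 * (n + 1)\<close>.\<close>
  obtain N where N: "6 * l\<^sup>2 / e < real N" using reals_Archimedean2 by blast
  \<comment> \<open>Two indices are lost: one because the inequality concerns
    \<open>y (Suc k)\<close>, one because \<open>j k\<close> bounds \<open>i\<close> only at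
    \<open>Suc k\<close>.\<close>
  have "\<forall>\<^sub>F n in sequentially. (a * p)\<^sup>2 * (n + 2) - e * B (n + 2) \<le> V (n + 2)"
    using evG evJ eventually_ge_at_top[of N]
  proof eventually_elim
    case (elim n)
    have "V (n + 2) = (y 0 - m)\<^sup>2 + (\<Sum>k<Suc n. (y (Suc k) - m)\<^sup>2)"
      unfolding V_def using sum.lessThan_Suc_shift[of "\<lambda>k. (y k - m)\<^sup>2" "Suc n"] by simp
    then have "(\<Sum>k<Suc n. (y (Suc k) - m)\<^sup>2) \<le> V (n + 2)" by simp
    moreover have "(\<Sum>k<Suc n. 2 * l * ((y (Suc k) - m) * \<psi> k) - l\<^sup>2) \<le> (\<Sum>k<Suc n. (y (Suc k) - m)\<^sup>2)"
    proof (rule sum_mono)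
      fix k
      have "0 \<le> (y (Suc k) - m - l * \<psi> k)\<^sup>2" by simp
      moreover have "l\<^sup>2 * (\<psi> k)\<^sup>2 \<le> l\<^sup>2 * 1"
        using psi[of k] by (intro mult_left_mono) (auto simp: abs_square_le_1)
      ultimately show "2 * l * ((y (Suc k) - m) * \<psi> k) - l\<^sup>2 \<le> (y (Suc k) - m)\<^sup>2"
        by (simp add: power2_eq_square algebra_simps)
    qed
    moreover have "(\<Sum>k<Suc n. 2 * l * ((y (Suc k) - m) * \<psi> k) - l\<^sup>2)
        = 2 * l * G (Suc n) + 2 * l * a * (\<Sum>k<Suc n. i k) - l\<^sup>2 * (n + 1)"
    proof -
      define X where "X k = (y (Suc k) - m) * \<psi> k" for k
      have "G (Suc n) = (\<Sum>k<Suc n. X k) - a * (\<Sum>k<Suc n. i k)"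
        unfolding G_def X_def sum_subtractf sum_distrib_left ..
      moreover have "(\<Sum>k<Suc n. 2 * l * X k - l\<^sup>2) = 2 * l * (\<Sum>k<Suc n. X k) - l\<^sup>2 * (n + 1)"
        unfolding sum_subtractf sum_distrib_left[symmetric] by (simp add: mult.commute)
      ultimately show ?thesis unfolding X_def[symmetric] by algebra
    qed
    \<comment> \<open>The state is positive for asymptotically at least a fraction \<open>p\<close>
      of the time, since every nonzero innovation forces it.\<close>
    moreover have "n * p + J n \<le> (\<Sum>k<Suc n. i k)"
    proof -
      have "n * p + J n = (\<Sum>k<n. j k)" by (simp add: J_def sum_subtractf)
      also have "\<dots> \<le> (\<Sum>k<n. i (Suc k))" by (intro sum_mono ji)
      also have "\<dots> \<le> (\<Sum>k<Suc n. i k)"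
        using i0[of 0] unfolding sum.lessThan_Suc_shift[of i n] by simp
      finally show ?thesis .
    qed
    then have "2 * l * a * (n * p + J n) \<le> 2 * l * a * (\<Sum>k<Suc n. i k)"
      using l a by (intro mult_left_mono) auto
    moreover have "2 * l * a * (n * p + J n) = 2 * l\<^sup>2 * n + 2 * l * a * J n"
      by (simp add: l_def power2_eq_square algebra_simps)
    moreover have "\<bar>2 * l * a * J n\<bar> \<le> e / 4 * n"
    proof -
      have "\<bar>2 * l * a * J n\<bar> = 2 * l * a * \<bar>J n\<bar>" using l a by (simp add: abs_mult)
      also have "\<dots> \<le> 2 * l * a * (e2 * n)" using l a elim by (intro mult_left_mono) auto
      also have "\<dots> = e / 4 * n" using l a by (simp add: e2_def)
      finally show ?thesis .
    qed
    moreover have "\<bar>2 * l * G (Suc n)\<bar> \<le> e / 4 * B (Suc n)"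
    proof -
      have "\<bar>2 * l * G (Suc n)\<bar> = 2 * l * \<bar>G (Suc n)\<bar>" using l by (simp add: abs_mult)
      also have "\<dots> \<le> 2 * l * (e1 * B (Suc n))" using l elim by (intro mult_left_mono) auto
      also have "\<dots> = e / 4 * B (Suc n)" using l by (simp add: e1_def)
      finally show ?thesis .
    qed
    moreover have "e / 4 * B (Suc n) \<le> e / 4 * B (n + 2)" using e by (intro mult_left_mono B_mono) auto
    moreover have nB: "real n \<le> B (n + 2)" using B_ge_n[of "n + 2"] by simp
    then have "e / 4 * n \<le> e / 4 * B (n + 2)" using e by (intro mult_left_mono) auto
    moreover have "3 * l\<^sup>2 \<le> e / 2 * B (n + 2)"
    proof -
      have "6 * l\<^sup>2 < e * N" using N e by (simp add: field_simps)
      also have "\<dots> \<le> e * B (n + 2)" using e nB elim by (intro mult_left_mono) auto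
      finally show ?thesis by simp
    qed
    ultimately have "2 * l\<^sup>2 * n - l\<^sup>2 * (n + 1) - e * B (n + 2) + 3 * l\<^sup>2 \<le> V (n + 2)" by linarith
    then show ?case by (simp add: l_def algebra_simps)
  qed
  then show ?thesis by (subst eventually_sequentially_seg[symmetric, of _ 2]) simp
qed

definition "w = (a * p)\<^sup>2 / ((a * p)\<^sup>2 + (1 + m)\<^sup>2)"

lemma w_pos: "0 < w"
  using a p by (auto simp: w_def intro!: divide_pos_pos add_pos_nonneg)

text \<open>The weights \<open>w\<close> and \<open>1 - w\<close> make the terms linear in \<open>n\<close> cancel.\<close>
lemma V_lower: "\<forall>\<^sub>F n in sequentially. w / 2 * B n \<le> V n"
proof -
  define L where "L = (a * p)\<^sup>2"
  define K where "K = (1 + m)\<^sup>2"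
  have L: "0 < L" "0 \<le> K" using a p by (auto simp: L_def K_def)
  have w: "w = L / (L + K)" by (simp add: w_def L_def K_def)
  have "0 < w / 2" using w_pos by simp
  from V_lower1[OF this] V_lower2[OF this] show ?thesis
  proof eventually_elim
    case (elim n)
    \<comment> \<open>The convex combination of the two lower bounds, multiplied by
      \<open>L + K\<close> to clear denominators.\<close>
    have "L * (B n - K * n - w / 2 * B n) + K * (L * n - w / 2 * B n) \<le> L * V n + K * V n"
      using elim L by (intro add_mono mult_left_mono) (auto simp: L_def K_def)
    moreover have "L * (B n - K * n - w / 2 * B n) + K * (L * n - w / 2 * B n)
        = (L - (L + K) * (w / 2)) * B n" by algebra
    ultimately have "(L - (L + K) * (w / 2)) * B n \<le> (L + K) * V n"
      by (simp only: distrib_right)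
    also have "L - (L + K) * (w / 2) = (L + K) * (w / 2)"
    proof -
      have "(L + K) * w = L" using add_pos_nonneg[OF L] by (simp add: w)
      then show ?thesis by simp
    qed
    finally have "(L + K) * (w / 2 * B n) \<le> (L + K) * V n" by (simp add: mult.assoc)
    then show ?case using L by (simp add: mult_le_cancel_left_pos)
  qed
qed

lemma over_B_limit:
  assumes "(\<lambda>n. f n / real n) \<longlonglongrightarrow> 0"
  shows "(\<lambda>n. f n / B n) \<longlonglongrightarrow> 0"
proof (rule Lim_null_comparison)
  show "(\<lambda>n. \<bar>f n / real n\<bar>) \<longlonglongrightarrow> 0" using tendsto_rabs_zero[OF assms] .
  show "\<forall>\<^sub>F n in sequentially. norm (f n / B n) \<le> \<bar>f n / real n\<bar>"
    using eventually_gt_at_top[of 0]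
  proof eventually_elim
    case (elim n)
    then show ?case using B_ge_n[of n] by (simp add: abs_divide frac_le)
  qed
qed

section \<open>The denominator and consistency along a path\<close>

text \<open>The main part of \<open>Dn\<close> is \<open>n * V n\<close>, at least
  \<open>w / 2 * (n * B n)\<close>. Centring at \<open>m\<close> instead of the sample mean and
  omitting time \<open>s\<close> cost only \<open>o(n * B n)\<close>.\<close>

lemma Dn_lower:
  assumes s: "1 \<le> s"
  shows "\<forall>\<^sub>F n in sequentially. w / 4 * (n * B n) \<le> Dn s n y"
proof -
  define u where "u = y (s - 1)"
  \<comment> \<open>The sizes, relative to \<open>n * B n\<close>, of the centring error, of the
    factor \<open>n - 1\<close> in place of \<open>n\<close>, and of the omitted
    observation.\<close>
  have lim: "(\<lambda>n. (S n / n - m)\<^sup>2 + 1 / n + u\<^sup>2 / n) \<longlonglongrightarrow> (m - m)\<^sup>2 + 0 + 0"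
    by (intro tendsto_intros mean_limit lim_const_over_n)
  have "\<forall>\<^sub>F n in sequentially. (S n / n - m)\<^sup>2 + 1 / n + u\<^sup>2 / n < w / 4"
    by (rule order_tendstoD(2)[OF lim]) (use w_pos in simp)
  from this V_lower eventually_ge_at_top[of s] show ?thesis
  proof eventually_elim
    case (elim n)
    define A where "A = (\<Sum>k<n. (y k)\<^sup>2)"
    have n: "0 < n" using s elim by simp
    have S1: "sumS s n (\<lambda>k. y (k - 1)) = S n - u"
      using s elim by (simp add: sumS_shift S_def u_def)
    have S2: "sumS s n (\<lambda>k. (y (k - 1))\<^sup>2) = A - u\<^sup>2"
      using s elim by (simp add: sumS_shift A_def u_def)
    have V: "V n = A - 2 * m * S n + m\<^sup>2 * n"
    proof -
      have "V n = (\<Sum>k<n. (y k)\<^sup>2 + (- 2 * m) * y k + m\<^sup>2)"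
        unfolding V_def by (intro sum.cong) (auto simp: power2_eq_square algebra_simps)
      then show ?thesis
        unfolding sum.distrib sum_distrib_left[symmetric] by (simp add: A_def S_def)
    qed
    have "Dn s n y = n * V n - (S n - m * n)\<^sup>2 - A - n * u\<^sup>2 + 2 * S n * u"
      unfolding Dn_def S1 S2 V by (simp add: power2_eq_square algebra_simps)
    moreover have "0 \<le> 2 * S n * u" using S_nonneg[of n] y0 by (simp add: u_def)
    moreover have "A \<le> B n" using B_ge(2)[of n] by (simp add: A_def)
    moreover have "(S n - m * n)\<^sup>2 \<le> (S n / n - m)\<^sup>2 * (n * B n)"
    proof -
      have "S n - m * n = (S n / n - m) * n" using n by (simp add: field_simps)
      then have "(S n - m * n)\<^sup>2 = (S n / n - m)\<^sup>2 * (n * n)"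
        by (simp add: power2_eq_square)
      also have "\<dots> \<le> (S n / n - m)\<^sup>2 * (n * B n)"
        using mult_left_mono[OF B_ge_n[of n], of "real n"] by (intro mult_left_mono) auto
      finally show ?thesis .
    qed
    moreover have "n * u\<^sup>2 \<le> u\<^sup>2 / n * (n * B n)"
    proof -
      have "n * u\<^sup>2 \<le> B n * u\<^sup>2" using B_ge_n[of n] by (intro mult_right_mono) auto
      then show ?thesis using n by (simp add: mult.commute)
    qed
    moreover have "B n = 1 / n * (n * B n)" using n by simp
    ultimately have "n * V n - ((S n / n - m)\<^sup>2 + 1 / n + u\<^sup>2 / n) * (n * B n) \<le> Dn s n y"
      by (simp only: distrib_right)
    moreover have "((S n / n - m)\<^sup>2 + 1 / n + u\<^sup>2 / n) * (n * B n) \<le> w / 4 * (n * B n)"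
      using elim B_pos[OF n] by (intro mult_right_mono) auto
    moreover have "n * (w / 2 * B n) \<le> n * V n" using elim by (intro mult_left_mono) auto
    ultimately show ?case by (simp add: algebra_simps)
  qed
qed

lemma Dn_pos:
  assumes s: "1 \<le> s"
  shows "\<forall>\<^sub>F n in sequentially. 0 < Dn s n y"
  using Dn_lower[OF s] eventually_gt_at_top[of 0]
proof eventually_elim
  case (elim n)
  have "0 < w / 4 * (n * B n)" using elim B_pos[of n] w_pos by simp
  then show ?case using elim by linarith
qed

lemma over_Dn_limit:
  assumes s: "1 \<le> s" and f: "(\<lambda>n. f n / (n * B n)) \<longlonglongrightarrow> 0"
  shows "(\<lambda>n. f n / Dn s n y) \<longlonglongrightarrow> 0"
proof (rule Lim_null_comparison)
  show "(\<lambda>n. 4 / w * \<bar>f n / (n * B n)\<bar>) \<longlonglongrightarrow> 0"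
    using tendsto_mult_right_zero[OF tendsto_rabs_zero[OF f]] .
  show "\<forall>\<^sub>F n in sequentially. norm (f n / Dn s n y) \<le> 4 / w * \<bar>f n / (n * B n)\<bar>"
    using Dn_lower[OF s] eventually_gt_at_top[of 0]
  proof eventually_elim
    case (elim n)
    have pos: "0 < n * B n" using elim B_pos[of n] by simp
    have "norm (f n / Dn s n y) = \<bar>f n\<bar> / \<bar>Dn s n y\<bar>" by simp
    also have "\<dots> \<le> \<bar>f n\<bar> / (w / 4 * (n * B n))"
    proof (intro divide_left_mono)
      have "0 < w / 4 * (n * B n)" using pos w_pos by simp
      then show "w / 4 * (n * B n) \<le> \<bar>Dn s n y\<bar>" "0 < \<bar>Dn s n y\<bar> * (w / 4 * (n * B n))"
        using elim(1) by (auto intro!: mult_pos_pos)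
    qed simp
    also have "\<dots> = 4 / w * \<bar>f n / (n * B n)\<bar>" using elim B_pos[of n] w_pos by (simp add: abs_divide abs_mult)
    finally show ?case .
  qed
qed

text \<open>Inserting the model equation into the numerators leaves the errors
  \<open>((n - 1) * Q n - R n * S1 n) / Dn\<close> for \<alpha> and
  \<open>(R n * S2 n - S1 n * Q n) / Dn\<close> for \<mu>. Here \<open>R n = o(n)\<close>,
  \<open>Q n = o(B n)\<close>, \<open>S1 n = O(n)\<close>, both \<open>S1 n\<close> and
  \<open>S2 n\<close> are at most \<open>B n\<close>, and \<open>Dn\<close> is at least of order
  \<open>n * B n\<close>.\<close>

lemma estimators_consistent:
  assumes s: "1 \<le> s"
  shows "(\<lambda>n. alpha_hat s n y) \<longlonglongrightarrow> \<alpha>" and "(\<lambda>n. mu_hat s n y) \<longlonglongrightarrow> \<mu>"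
    and "(\<lambda>n. theta_hat s n y) \<longlonglongrightarrow> y s - \<alpha> * y (s - 1) - \<mu>"
proof -
  define S1 where "S1 n = sumS s n (\<lambda>k. y (k - 1))" for n
  define S2 where "S2 n = sumS s n (\<lambda>k. (y (k - 1))\<^sup>2)" for n
  define R where "R n = sumS s n (\<lambda>k. d (k - 1))" for n
  define Q where "Q n = sumS s n (\<lambda>k. y (k - 1) * d (k - 1))" for n
  \<comment> \<open>Away from \<open>s\<close> the outlier is absent, and \<open>k \<ge> 1\<close>
    gives \<open>Suc (k - 1) = k\<close>.\<close>
  have yk: "y k = \<alpha> * y (k - 1) + \<mu> + d (k - 1)" if "k \<in> {1..n} - {s}" for k n
    using that rec[of "k - 1"] by auto
  have T: "sumS s n y = \<alpha> * S1 n + (n - 1) * \<mu> + R n" if "s \<le> n" for n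
  proof -
    have "sumS s n y = sumS s n (\<lambda>k. \<alpha> * y (k - 1) + \<mu> + d (k - 1))"
      unfolding sumS_def by (intro sum.cong refl yk)
    then show ?thesis unfolding sumS_add sumS_scale sumS_const[OF s that] S1_def R_def
      using s that by (simp add: of_nat_diff)
  qed
  have P: "sumS s n (\<lambda>k. y (k - 1) * y k) = \<alpha> * S2 n + \<mu> * S1 n + Q n" for n
  proof -
    have "sumS s n (\<lambda>k. y (k - 1) * y k)
        = sumS s n (\<lambda>k. \<alpha> * (y (k - 1))\<^sup>2 + \<mu> * y (k - 1) + y (k - 1) * d (k - 1))"
      unfolding sumS_def by (intro sum.cong refl) (subst yk, auto simp: power2_eq_square algebra_simps)
    then show ?thesis unfolding sumS_add sumS_scale S1_def S2_def Q_def .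
  qed
  \<comment> \<open>Dropping the single index \<open>s\<close> changes the sum by a constant; the
    same remark serves \<open>Q\<close> and \<open>S1\<close>.\<close>
  have Rn: "(\<lambda>n. R n / n) \<longlonglongrightarrow> 0"
  proof -
    have "(\<lambda>n. (\<Sum>k<n. d k) / n - d (s - 1) / n) \<longlonglongrightarrow> 0 - 0"
      by (intro tendsto_diff div_n_limit[OF sum_d] lim_const_over_n)
    moreover have "\<forall>\<^sub>F n in sequentially. (\<Sum>k<n. d k) / n - d (s - 1) / n = R n / n"
      using eventually_ge_at_top[of s]
      by eventually_elim (use s in \<open>simp add: R_def sumS_shift diff_divide_distrib\<close>)
    ultimately show ?thesis by (simp add: tendsto_cong)
  qed
  have QB: "(\<lambda>n. Q n / B n) \<longlonglongrightarrow> 0"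
  proof -
    have "(\<lambda>n. (\<Sum>k<n. y k * d k) / B n - (y (s - 1) * d (s - 1)) / B n) \<longlonglongrightarrow> 0 - 0"
      using sum_yd unfolding B_def[symmetric]
      by (intro tendsto_diff over_B_limit[of "\<lambda>_. y (s - 1) * d (s - 1)"] lim_const_over_n)
    moreover have "\<forall>\<^sub>F n in sequentially.
        (\<Sum>k<n. y k * d k) / B n - (y (s - 1) * d (s - 1)) / B n = Q n / B n"
      using eventually_ge_at_top[of s]
      by eventually_elim (use s in \<open>simp add: Q_def sumS_shift diff_divide_distrib\<close>)
    ultimately show ?thesis by (simp add: tendsto_cong)
  qed
  have S1n: "(\<lambda>n. S1 n / n) \<longlonglongrightarrow> m"
  proof -
    have "(\<lambda>n. S n / n - y (s - 1) / n) \<longlonglongrightarrow> m - 0"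
      by (intro tendsto_diff mean_limit lim_const_over_n)
    moreover have "\<forall>\<^sub>F n in sequentially. S n / n - y (s - 1) / n = S1 n / n"
      using eventually_ge_at_top[of s]
      by eventually_elim (use s in \<open>simp add: S1_def S_def sumS_shift diff_divide_distrib\<close>)
    ultimately show ?thesis by (simp add: tendsto_cong)
  qed
  have S1B: "0 \<le> S1 n" "S1 n \<le> B n" if "s \<le> n" for n
  proof -
    show "0 \<le> S1 n" unfolding S1_def sumS_def using y0 by (intro sum_nonneg) auto
    have "S1 n \<le> S n" using s that y0[of "s - 1"] by (simp add: S1_def S_def sumS_shift)
    then show "S1 n \<le> B n" using B_ge(1)[of n] by simp
  qed
  have S2B: "0 \<le> S2 n" "S2 n \<le> B n" if "s \<le> n" for n
  proof -
    show "0 \<le> S2 n" unfolding S2_def sumS_def by (intro sum_nonneg) auto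
    have "S2 n \<le> (\<Sum>k<n. (y k)\<^sup>2)" using s that by (simp add: S2_def sumS_shift)
    then show "S2 n \<le> B n" using B_ge(2)[of n] by simp
  qed
  have RB: "(\<lambda>n. R n * f n / (n * B n)) \<longlonglongrightarrow> 0"
    if f: "\<And>n. s \<le> n \<Longrightarrow> 0 \<le> f n" "\<And>n. s \<le> n \<Longrightarrow> f n \<le> B n" for f
  proof (rule Lim_null_comparison)
    show "(\<lambda>n. \<bar>R n / n\<bar>) \<longlonglongrightarrow> 0" using tendsto_rabs_zero[OF Rn] .
    show "\<forall>\<^sub>F n in sequentially. norm (R n * f n / (n * B n)) \<le> \<bar>R n / n\<bar>"
      using eventually_ge_at_top[of s] eventually_gt_at_top[of 0]
    proof eventually_elim
      case (elim n)
      have "norm (R n * f n / (n * B n)) = \<bar>R n / n\<bar> * (f n / B n)"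
        using f[of n] elim B_pos[of n] by (simp add: abs_mult abs_divide)
      also have "\<dots> \<le> \<bar>R n / n\<bar> * 1"
        using f[of n] elim B_pos[of n] by (intro mult_left_mono) auto
      finally show ?case by simp
    qed
  qed
  have "(\<lambda>n. ((real n - 1) * Q n - R n * S1 n) / (n * B n)) \<longlonglongrightarrow> 0"
  proof -
    have "(\<lambda>n. (1 - 1 / n) * (Q n / B n) - R n * S1 n / (n * B n)) \<longlonglongrightarrow> (1 - 0) * 0 - 0"
      by (intro tendsto_intros lim_const_over_n QB RB S1B)
    moreover have "\<forall>\<^sub>F n in sequentially. (1 - 1 / n) * (Q n / B n) - R n * S1 n / (n * B n)
        = ((real n - 1) * Q n - R n * S1 n) / (n * B n)"
      using eventually_gt_at_top[of 0]
    proof eventually_elim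
      case (elim n)
      then show ?case using B_pos[of n] by (simp add: field_simps)
    qed
    ultimately show ?thesis by (simp add: tendsto_cong)
  qed
  then have "(\<lambda>n. \<alpha> + ((real n - 1) * Q n - R n * S1 n) / Dn s n y) \<longlonglongrightarrow> \<alpha> + 0"
    by (intro tendsto_add tendsto_const over_Dn_limit[OF s])
  moreover have "\<forall>\<^sub>F n in sequentially.
      \<alpha> + ((real n - 1) * Q n - R n * S1 n) / Dn s n y = alpha_hat s n y"
    using eventually_ge_at_top[of s] Dn_pos[OF s]
  proof eventually_elim
    case (elim n)
    have "(real n - 1) * sumS s n (\<lambda>k. y (k - 1) * y k) - sumS s n y * sumS s n (\<lambda>k. y (k - 1))
        = \<alpha> * Dn s n y + ((real n - 1) * Q n - R n * S1 n)"
      unfolding T[OF elim(1)] P Dn_def S1_def[symmetric] S2_def[symmetric]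
      by (simp add: algebra_simps power2_eq_square)
    then show ?case unfolding alpha_hat_def using elim(2) by (simp add: add_divide_distrib)
  qed
  ultimately show al: "(\<lambda>n. alpha_hat s n y) \<longlonglongrightarrow> \<alpha>" by (simp add: tendsto_cong)
  have "(\<lambda>n. (R n * S2 n - S1 n * Q n) / (n * B n)) \<longlonglongrightarrow> 0"
  proof -
    have "(\<lambda>n. R n * S2 n / (n * B n) - (S1 n / n) * (Q n / B n)) \<longlonglongrightarrow> 0 - m * 0"
      by (intro tendsto_intros S1n QB RB S2B)
    then show ?thesis by (simp add: diff_divide_distrib)
  qed
  then have "(\<lambda>n. \<mu> + (R n * S2 n - S1 n * Q n) / Dn s n y) \<longlonglongrightarrow> \<mu> + 0"
    by (intro tendsto_add tendsto_const over_Dn_limit[OF s])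
  moreover have "\<forall>\<^sub>F n in sequentially. \<mu> + (R n * S2 n - S1 n * Q n) / Dn s n y = mu_hat s n y"
    using eventually_ge_at_top[of s] Dn_pos[OF s]
  proof eventually_elim
    case (elim n)
    have "sumS s n (\<lambda>k. (y (k - 1))\<^sup>2) * sumS s n y - sumS s n (\<lambda>k. y (k - 1)) * sumS s n (\<lambda>k. y (k - 1) * y k)
        = \<mu> * Dn s n y + (R n * S2 n - S1 n * Q n)"
      unfolding T[OF elim(1)] P Dn_def S1_def[symmetric] S2_def[symmetric]
      by (simp add: algebra_simps power2_eq_square)
    then show ?case unfolding mu_hat_def using elim(2) by (simp add: add_divide_distrib)
  qed
  ultimately show mu: "(\<lambda>n. mu_hat s n y) \<longlonglongrightarrow> \<mu>" by (simp add: tendsto_cong)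
  show "(\<lambda>n. theta_hat s n y) \<longlonglongrightarrow> y s - \<alpha> * y (s - 1) - \<mu>"
    unfolding theta_hat_def by (intro tendsto_intros al mu)
qed

end

subsection \<open>The INAR(1) process\<close>

lemma nat_add_measurable:
  fixes f g :: "'a \<Rightarrow> nat"
  assumes f: "f \<in> measurable N (count_space UNIV)" and g: "g \<in> measurable N (count_space UNIV)"
  shows "(\<lambda>\<omega>. f \<omega> + g \<omega>) \<in> measurable N (count_space UNIV)"
proof (rule measurable_compose_countable[where f="\<lambda>i \<omega>. i + g \<omega>", OF _ f])
  show "(\<lambda>\<omega>. i + g \<omega>) \<in> measurable N (count_space UNIV)" for i
    by (rule measurable_compose[OF g]) simp
qed

lemma nat_sum_measurable:
  fixes f :: "'b \<Rightarrow> 'a \<Rightarrow> nat"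
  assumes "\<And>i. i \<in> I \<Longrightarrow> f i \<in> measurable N (count_space UNIV)"
  shows "(\<lambda>\<omega>. \<Sum>i\<in>I. f i \<omega>) \<in> measurable N (count_space UNIV)"
  using assms
  by (induction I rule: infinite_finite_induct) (auto intro: nat_add_measurable)

locale inar = prob_space M for M :: "'a measure" +
  fixes Y0 :: "'a \<Rightarrow> nat"
    and eps :: "nat \<Rightarrow> 'a \<Rightarrow> nat"
    and xi :: "nat \<Rightarrow> nat \<Rightarrow> 'a \<Rightarrow> nat"
    and \<alpha> :: real
    and s \<theta> :: nat
  assumes alpha: "0 < \<alpha>" "\<alpha> < 1"
    and indep: "indep_vars (\<lambda>_. count_space UNIV) (inar_family Y0 eps xi) inar_index"
    and eps_id: "\<And>k. 1 \<le> k \<Longrightarrow>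
                   distr M (count_space UNIV) (eps k) = distr M (count_space UNIV) (eps 1)"
    and eps_sq: "integrable M (\<lambda>\<omega>. (real (eps 1 \<omega>))\<^sup>2)"
    and eps_nz: "measure M {\<omega> \<in> space M. eps 1 \<omega> \<noteq> 0} > 0"
    and xi_bern: "\<And>k j. 1 \<le> k \<Longrightarrow> 1 \<le> j \<Longrightarrow>
                   distr M (count_space UNIV) (xi k j) = measure_pmf (map_pmf of_bool (bernoulli_pmf \<alpha>))"
begin

section \<open>Generated sigma-algebras and the filtration of the model\<close>

text \<open>The sigma-algebra generated by the sources in \<open>A\<close>, encoded as a pullback of
  the product sigma-algebra: in this form independence of disjoint blocks of sources transfers
  directly.\<close>

definition gen :: "inar_src set \<Rightarrow> 'a measure" where
  "gen A = vimage_algebra (space M) (\<lambda>\<omega>. restrict (\<lambda>i. inar_family Y0 eps xi i \<omega>) A)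
             (PiM A (\<lambda>_. count_space UNIV))"

text \<open>All counting variables up to time \<open>n\<close> are included, for every
  \<open>j\<close>, because the number actually summed is random and unbounded.\<close>

definition past :: "nat \<Rightarrow> inar_src set" where
  "past n = {SrcY0} \<union> SrcEps ` {1..n} \<union> (\<lambda>(k, j). SrcXi k j) ` ({1..n} \<times> {1..})"

definition fresh :: "nat \<Rightarrow> inar_src set" where
  "fresh n = insert (SrcEps (Suc n)) (SrcXi (Suc n) ` {1..})"

abbreviation "Y \<equiv> inarY Y0 eps xi s \<theta>"

lemma space_gen[simp]: "space (gen A) = space M"
  by (simp add: gen_def)

lemma family_measurable_gen:
  assumes "i \<in> A"
  shows "inar_family Y0 eps xi i \<in> measurable (gen A) (count_space UNIV)"
proof -
  have "(\<lambda>\<omega>. restrict (\<lambda>i. inar_family Y0 eps xi i \<omega>) A) \<in> measurable (gen A) (PiM A (\<lambda>_. count_space UNIV))"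
    unfolding gen_def by (rule measurable_vimage_algebra1) (auto simp: space_PiM)
  from measurable_compose[OF this measurable_component_singleton[OF assms]] show ?thesis
    using assms by simp
qed

lemma subalgebra_gen:
  assumes sp: "space N = space M"
    and X: "\<And>i. i \<in> A \<Longrightarrow> inar_family Y0 eps xi i \<in> measurable N (count_space UNIV)"
  shows "subalgebra N (gen A)"
proof -
  have "(\<lambda>\<omega>. restrict (\<lambda>i. inar_family Y0 eps xi i \<omega>) A) \<in> measurable N (PiM A (\<lambda>_. count_space UNIV))"
    using X by (intro measurable_restrict) auto
  from measurable_sets[OF this] have "sets (gen A) \<subseteq> sets N"
    unfolding gen_def sets_vimage_algebra sp[symmetric]
    by (intro sets.sigma_sets_subset) blast
  then show ?thesis by (simp add: subalgebra_def sp)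
qed

lemma gen_mono: "A \<subseteq> A' \<Longrightarrow> subalgebra (gen A') (gen A)"
  by (intro subalgebra_gen family_measurable_gen) auto

lemma subalgebra_M_gen: "A \<subseteq> inar_index \<Longrightarrow> subalgebra M (gen A)"
proof (rule subalgebra_gen)
  show "inar_family Y0 eps xi i \<in> measurable M (count_space UNIV)" if "A \<subseteq> inar_index" "i \<in> A" for i
    using indep that unfolding indep_vars_def by blast
qed simp_all

lemma indep_gen:
  assumes "A \<inter> A' = {}" "A \<subseteq> inar_index" "A' \<subseteq> inar_index"
  shows "indep_set (sets (gen A)) (sets (gen A'))"
  using indep_var_restrict[OF indep assms] unfolding indep_var_eq gen_def sets_vimage_algebra by simp

lemma expectation_mult_gen:
  fixes f g :: "'a \<Rightarrow> real"
  assumes "A \<inter> A' = {}" "A \<subseteq> inar_index" "A' \<subseteq> inar_index"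
    and "f \<in> borel_measurable (gen A)" "g \<in> borel_measurable (gen A')"
    and "integrable M f" "integrable M g"
  shows "expectation (\<lambda>\<omega>. f \<omega> * g \<omega>) = expectation f * expectation g"
  using assms
  by (intro indep_var_lebesgue_integral indep_var_of_indep_set[of "gen A" "gen A'"]
      subalgebra_M_gen indep_gen)

lemma past_fresh:
  "past n \<subseteq> inar_index" "fresh n \<subseteq> inar_index" "past n \<inter> fresh n = {}"
  "past n \<subseteq> past (Suc n)" "fresh n \<subseteq> past (Suc n)"
  unfolding past_def fresh_def inar_index_def by (auto simp: image_iff)

lemma eps_measurable_gen: "SrcEps k \<in> A \<Longrightarrow> eps k \<in> measurable (gen A) (count_space UNIV)"
  using family_measurable_gen[of "SrcEps k" A] by (simp add: inar_family_def[abs_def])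

lemma xi_measurable_gen: "SrcXi k j \<in> A \<Longrightarrow> xi k j \<in> measurable (gen A) (count_space UNIV)"
  using family_measurable_gen[of "SrcXi k j" A] by (simp add: inar_family_def[abs_def])

lemma Y_measurable: "Y n \<in> measurable (gen (past n)) (count_space UNIV)"
proof (induction n)
  case 0
  have "SrcY0 \<in> past 0" by (simp add: past_def)
  from family_measurable_gen[OF this] show ?case by (simp add: inar_family_def[abs_def])
next
  case (Suc n)
  have Yn: "Y n \<in> measurable (gen (past (Suc n))) (count_space UNIV)"
    by (rule measurable_from_subalg[OF gen_mono[OF past_fresh(4)] Suc])
  \<comment> \<open>The summation bound is random: freeze it at \<open>y\<close>, then recombine
    over its countably many values.\<close>
  have "(\<lambda>\<omega>. (\<Sum>j = 1..y. xi (Suc n) j \<omega>) + eps (Suc n) \<omega> + (if Suc n = s then \<theta> else 0))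
      \<in> measurable (gen (past (Suc n))) (count_space UNIV)" for y
    by (intro nat_add_measurable nat_sum_measurable xi_measurable_gen eps_measurable_gen)
       (auto simp: past_def)
  from measurable_compose_countable[OF this Yn] show ?case by (simp add: fun_eq_iff)
qed

lemma eps_measurable[measurable]: "1 \<le> k \<Longrightarrow> eps k \<in> measurable M (count_space UNIV)"
  by (rule measurable_from_subalg[OF subalgebra_M_gen eps_measurable_gen[of k "{SrcEps k}"]])
     (auto simp: inar_index_def)

lemma xi_measurable[measurable]: "1 \<le> k \<Longrightarrow> 1 \<le> j \<Longrightarrow> xi k j \<in> measurable M (count_space UNIV)"
  by (rule measurable_from_subalg[OF subalgebra_M_gen xi_measurable_gen[of k j "{SrcXi k j}"]])
     (auto simp: inar_index_def image_iff)

section \<open>Moments of the one-step noise\<close>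

lemma eps_transfer:
  fixes f :: "nat \<Rightarrow> real"
  assumes k: "1 \<le> k"
  shows "integrable M (\<lambda>\<omega>. f (eps k \<omega>)) \<longleftrightarrow> integrable M (\<lambda>\<omega>. f (eps 1 \<omega>))"
    and "expectation (\<lambda>\<omega>. f (eps k \<omega>)) = expectation (\<lambda>\<omega>. f (eps 1 \<omega>))"
  using integrable_distr_eq[OF eps_measurable[OF k], of f] integrable_distr_eq[OF eps_measurable[of 1], of f]
    integral_distr[OF eps_measurable[OF k], of f] integral_distr[OF eps_measurable[of 1], of f]
    eps_id[OF k]
  by simp_all

lemma xi_transfer:
  fixes f :: "nat \<Rightarrow> real"
  assumes kj: "1 \<le> k" "1 \<le> j"
  shows "integrable M (\<lambda>\<omega>. f (xi k j \<omega>))"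
    and "expectation (\<lambda>\<omega>. f (xi k j \<omega>)) = \<alpha> * f 1 + (1 - \<alpha>) * f 0"
proof -
  have "integrable (distr M (count_space UNIV) (xi k j)) f"
    unfolding xi_bern[OF kj]
    by (rule integrable_measure_pmf_finite) (simp add: finite_subset[OF subset_UNIV])
  then show "integrable M (\<lambda>\<omega>. f (xi k j \<omega>))"
    using integrable_distr_eq[OF xi_measurable[OF kj], of f] by simp
  have "expectation (\<lambda>\<omega>. f (xi k j \<omega>)) = integral\<^sup>L (distr M (count_space UNIV) (xi k j)) f"
    using integral_distr[OF xi_measurable[OF kj], of f] by simp
  also have "\<dots> = \<alpha> * f 1 + (1 - \<alpha>) * f 0"
    unfolding xi_bern[OF kj] using alpha by (simp add: integral_map_pmf mult.commute)
  finally show "expectation (\<lambda>\<omega>. f (xi k j \<omega>)) = \<alpha> * f 1 + (1 - \<alpha>) * f 0" .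
qed

lemma AE_xi_01:
  assumes kj: "1 \<le> k" "1 \<le> j"
  shows "AE \<omega> in M. xi k j \<omega> \<in> {0, 1}"
proof -
  have "AE x in distr M (count_space UNIV) (xi k j). x \<in> {0, 1}"
    unfolding xi_bern[OF kj] by (auto simp: AE_measure_pmf_iff)
  then show ?thesis
    using AE_distr_iff[OF xi_measurable[OF kj], of "\<lambda>x. x \<in> {0, 1}"] by simp
qed

definition "\<mu> = expectation (\<lambda>\<omega>. real (eps 1 \<omega>))"
definition "\<sigma>2 = expectation (\<lambda>\<omega>. (real (eps 1 \<omega>) - \<mu>)\<^sup>2)"
definition "nz = expectation (\<lambda>\<omega>. of_bool (eps 1 \<omega> \<noteq> 0) :: real)"
text \<open>The index is shifted so that \<open>x n j\<close> belongs to the step from time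
  \<open>n\<close> to \<open>n + 1\<close>, that is, to \<open>fresh n\<close>.\<close>

definition "x n j \<omega> = real (xi (Suc n) j \<omega>) - \<alpha>"
text \<open>The deviation of the next state from \<open>\<alpha> * y + \<mu>\<close> when the
  current state is frozen at \<open>y\<close>, without the deterministic outlier. Inserting
  \<open>Y n\<close> for \<open>y\<close> gives the martingale difference
  \<open>d_n\<close>.\<close>

definition "D n y \<omega> = real (eps (Suc n) \<omega>) - \<mu> + (\<Sum>j=1..y. x n j \<omega>)"

lemma nz_pos: "0 < nz"
proof -
  have "nz = expectation (indicator {\<omega> \<in> space M. eps 1 \<omega> \<noteq> 0})"
    unfolding nz_def by (intro Bochner_Integration.integral_cong) (auto simp: indicator_def)
  also have "\<dots> = prob {\<omega> \<in> space M. eps 1 \<omega> \<noteq> 0}"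
    by (simp add: Int_def conj_commute)
  finally show ?thesis using eps_nz by simp
qed

lemma integrable_eps1: "integrable M (\<lambda>\<omega>. real (eps 1 \<omega>))"
  by (rule square_integrable_imp_integrable[OF _ eps_sq]) simp

lemma eps_centred:
  "integrable M (\<lambda>\<omega>. real (eps (Suc n) \<omega>) - \<mu>)"
  "expectation (\<lambda>\<omega>. real (eps (Suc n) \<omega>) - \<mu>) = 0"
  "integrable M (\<lambda>\<omega>. (real (eps (Suc n) \<omega>) - \<mu>)\<^sup>2)"
  "expectation (\<lambda>\<omega>. (real (eps (Suc n) \<omega>) - \<mu>)\<^sup>2) = \<sigma>2"
proof -
  note tr = eps_transfer[of "Suc n", where f="\<lambda>k. real k - \<mu>"]
    eps_transfer[of "Suc n", where f="\<lambda>k. (real k - \<mu>)\<^sup>2"]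
  show "integrable M (\<lambda>\<omega>. real (eps (Suc n) \<omega>) - \<mu>)"
       "expectation (\<lambda>\<omega>. real (eps (Suc n) \<omega>) - \<mu>) = 0"
    using tr integrable_eps1 by (simp_all add: \<mu>_def prob_space)
  have "integrable M (\<lambda>\<omega>. (real (eps 1 \<omega>) - \<mu>)\<^sup>2)"
    unfolding power2_diff using eps_sq integrable_eps1 by simp
  then show "integrable M (\<lambda>\<omega>. (real (eps (Suc n) \<omega>) - \<mu>)\<^sup>2)"
       "expectation (\<lambda>\<omega>. (real (eps (Suc n) \<omega>) - \<mu>)\<^sup>2) = \<sigma>2"
    using tr by (simp_all add: \<sigma>2_def)
qed

lemma x_moments:
  assumes "1 \<le> j"
  shows "integrable M (x n j)" "expectation (x n j) = 0"
    "integrable M (\<lambda>\<omega>. (x n j \<omega>)\<^sup>2)" "expectation (\<lambda>\<omega>. (x n j \<omega>)\<^sup>2) = \<alpha> * (1 - \<alpha>)"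
  using xi_transfer[of "Suc n" j, where f="\<lambda>k. real k - \<alpha>"]
    xi_transfer[of "Suc n" j, where f="\<lambda>k. (real k - \<alpha>)\<^sup>2"] assms
  by (simp_all add: x_def[abs_def] power2_eq_square algebra_simps)

lemma x_meas_gen: "SrcXi (Suc n) j \<in> A \<Longrightarrow> x n j \<in> borel_measurable (gen A)"
  unfolding x_def[abs_def] using measurable_compose[OF xi_measurable_gen, of "Suc n" j A "\<lambda>k. real k - \<alpha>" borel]
  by simp

text \<open>Just the sources that \<open>D n y\<close> reads, so that counting variables of the same
  step with larger index remain independent of it.\<close>

definition "src n y = insert (SrcEps (Suc n)) (SrcXi (Suc n) ` {1..y})"

lemma src_index: "src n y \<subseteq> inar_index" "src n y \<subseteq> fresh n"
  unfolding src_def fresh_def inar_index_def by (auto simp: image_iff)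

lemma D_meas_gen: "src n y \<subseteq> A \<Longrightarrow> D n y \<in> borel_measurable (gen A)"
  unfolding D_def[abs_def] src_def
  using measurable_compose[OF eps_measurable_gen, of "Suc n" A "\<lambda>k. real k - \<mu>" borel]
  by (intro borel_measurable_add borel_measurable_sum x_meas_gen) auto

lemma D_meas[measurable]: "D n y \<in> borel_measurable M"
  by (rule measurable_from_subalg[OF subalgebra_M_gen D_meas_gen[OF order_refl]]) (rule src_index)

lemma D_Suc: "D n (Suc y) \<omega> = D n y \<omega> + x n (Suc y) \<omega>"
  by (simp add: D_def)

lemma D_mean: "integrable M (D n y)" "expectation (D n y) = 0"
proof -
  have i: "integrable M (\<lambda>\<omega>. \<Sum>j=1..y. x n j \<omega>)"
    by (intro Bochner_Integration.integrable_sum x_moments) auto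
  then show "integrable M (D n y)"
    unfolding D_def[abs_def] by (intro Bochner_Integration.integrable_add eps_centred)
  have "expectation (\<lambda>\<omega>. \<Sum>j=1..y. x n j \<omega>) = (\<Sum>j=1..y. expectation (x n j))"
    by (intro Bochner_Integration.integral_sum x_moments) auto
  also have "\<dots> = 0" by (intro sum.neutral) (auto simp: x_moments)
  finally show "expectation (D n y) = 0"
    unfolding D_def[abs_def] using Bochner_Integration.integral_add[OF eps_centred(1)[of n] i]
    by (simp add: eps_centred)
qed

lemma xi_single_index: "1 \<le> j \<Longrightarrow> {SrcXi (Suc n) j} \<subseteq> inar_index"
  by (auto simp: inar_index_def image_iff)

lemma D_x_orth:
  assumes "y < j"
  shows "expectation (\<lambda>\<omega>. D n y \<omega> * x n j \<omega>) = 0"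
proof -
  have "expectation (\<lambda>\<omega>. D n y \<omega> * x n j \<omega>) = expectation (D n y) * expectation (x n j)"
    using assms
    by (intro expectation_mult_gen[of "src n y" "{SrcXi (Suc n) j}"] D_meas_gen x_meas_gen
        D_mean x_moments src_index xi_single_index) (auto simp: src_def)
  then show ?thesis by (simp add: D_mean)
qed

lemma x_meas[measurable]: "1 \<le> j \<Longrightarrow> x n j \<in> borel_measurable M"
  by (rule borel_measurable_integrable[OF x_moments(1)])

text \<open>The counting variables enter one at a time, each orthogonal to the sum before it, so the
  variances add up. The conditional variance is thus affine in the state.\<close>

lemma D_square:
  "integrable M (\<lambda>\<omega>. (D n y \<omega>)\<^sup>2) \<and> expectation (\<lambda>\<omega>. (D n y \<omega>)\<^sup>2) = \<sigma>2 + y * (\<alpha> * (1 - \<alpha>))"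
proof (induction y)
  case 0
  then show ?case using eps_centred by (simp add: D_def)
next
  case (Suc y)
  have i: "integrable M (\<lambda>\<omega>. D n y \<omega> * x n (Suc y) \<omega>)"
    using Suc x_moments[of "Suc y" n] by (intro integrable_mult_of_squares) auto
  have eq: "(D n (Suc y) \<omega>)\<^sup>2 = (D n y \<omega>)\<^sup>2 + (x n (Suc y) \<omega>)\<^sup>2 + 2 * (D n y \<omega> * x n (Suc y) \<omega>)" for \<omega>
    by (simp add: D_Suc power2_sum mult.assoc)
  show ?case unfolding eq using Suc x_moments[of "Suc y" n] i D_x_orth[of y "Suc y" n]
    by (simp add: algebra_simps)
qed

text \<open>Only the summand \<open>j = 1\<close> of \<open>D n y\<close> is correlated with
  \<open>x n 1\<close>, and it is present exactly when \<open>y \<ge> 1\<close>. This covariance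
  keeps the path from being degenerate.\<close>

lemma D_x1:
  "expectation (\<lambda>\<omega>. D n y \<omega> * x n 1 \<omega>) = \<alpha> * (1 - \<alpha>) * of_bool (1 \<le> y)"
proof (cases y)
  case 0
  then show ?thesis using D_x_orth[of 0 1 n] by simp
next
  case (Suc z)
  have i: "integrable M (\<lambda>\<omega>. D n y \<omega> * x n j \<omega>)" if "1 \<le> j" for y j
    using D_square x_moments[OF that] that by (intro integrable_mult_of_squares) auto
  have xx: "integrable M (\<lambda>\<omega>. x n j \<omega> * x n 1 \<omega>)" if "1 \<le> j" for j
    using x_moments[OF that] x_moments[of 1] that by (intro integrable_mult_of_squares) auto
  have "expectation (\<lambda>\<omega>. D n (Suc z) \<omega> * x n 1 \<omega>) = \<alpha> * (1 - \<alpha>)"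
  proof (induction z)
    case 0
    have eq: "D n (Suc 0) \<omega> * x n 1 \<omega> = D n 0 \<omega> * x n 1 \<omega> + (x n 1 \<omega>)\<^sup>2" for \<omega>
      by (simp add: D_Suc power2_eq_square algebra_simps)
    show ?case unfolding eq using i[of 1 0] x_moments[of 1 n] D_x_orth[of 0 1 n] by simp
  next
    case (Suc z)
    have eq: "D n (Suc (Suc z)) \<omega> * x n 1 \<omega> = D n (Suc z) \<omega> * x n 1 \<omega> + x n (Suc (Suc z)) \<omega> * x n 1 \<omega>" for \<omega>
      by (simp add: D_Suc[of n "Suc z"] algebra_simps)
    have "expectation (\<lambda>\<omega>. x n (Suc (Suc z)) \<omega> * x n 1 \<omega>)
        = expectation (x n (Suc (Suc z))) * expectation (x n 1)"
      by (intro expectation_mult_gen[of "{SrcXi (Suc n) (Suc (Suc z))}" "{SrcXi (Suc n) 1}"] x_meas_gen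
        x_moments xi_single_index) auto
    also have "\<dots> = 0" by (simp add: x_moments)
    finally show ?case unfolding eq using Suc i[of 1 "Suc z"] xx[of "Suc (Suc z)"] by simp
  qed
  then show ?thesis using Suc by simp
qed

lemma AE_x1_le: "AE \<omega> in M. \<bar>x n 1 \<omega>\<bar> \<le> 1"
proof -
  have "AE \<omega> in M. xi (Suc n) 1 \<omega> \<in> {0, 1}" by (rule AE_xi_01) auto
  then show ?thesis by eventually_elim (use alpha in \<open>auto simp: x_def\<close>)
qed

section \<open>Strong laws along the process\<close>

lemma inar_slln:
  fixes U :: "nat \<Rightarrow> nat \<Rightarrow> 'a \<Rightarrow> real" and b :: "nat \<Rightarrow> real"
  assumes "\<And>n y. U n y \<in> borel_measurable (gen (fresh n))"
    and "\<And>n y. expectation (U n y) = 0" "\<And>n y. integrable M (\<lambda>\<omega>. (U n y \<omega>)\<^sup>2)"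
    and "\<And>n y. expectation (\<lambda>\<omega>. (U n y \<omega>)\<^sup>2) \<le> C * (b y * sqrt (b y))" and "\<And>y. 1 \<le> b y"
  shows "AE \<omega> in M. (\<lambda>n. (\<Sum>k<n. U k (Y k \<omega>) \<omega>) / (\<Sum>k<n. b (Y k \<omega>))) \<longlonglongrightarrow> 0"
  by (rule self_normalized_slln[OF subalgebra_M_gen subalgebra_M_gen gen_mono gen_mono indep_gen Y_measurable assms])
     (rule past_fresh)+

lemma sigma2_nonneg: "0 \<le> \<sigma>2" by (simp add: \<sigma>2_def)

lemma D_square_le: "expectation (\<lambda>\<omega>. (D n y \<omega>)\<^sup>2) \<le> (1 + \<sigma>2) * (1 + real y)"
proof -
  have "\<alpha> * (1 - \<alpha>) \<le> 1" using alpha by (simp add: mult_le_one)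
  then have "y * (\<alpha> * (1 - \<alpha>)) \<le> real y" by (simp add: mult_left_le)
  moreover have "0 \<le> \<sigma>2 * real y" using sigma2_nonneg by simp
  ultimately show ?thesis using D_square[of n y] by (simp add: algebra_simps)
qed

text \<open>The variance is linear in \<open>y\<close>, hence at most a constant times
  \<open>b \<le> b * sqrt b\<close> for \<open>b = 1 + y\<close>.\<close>

lemma slln_D: "AE \<omega> in M. (\<lambda>n. (\<Sum>k<n. D k (Y k \<omega>) \<omega>) / (\<Sum>k<n. 1 + real (Y k \<omega>))) \<longlonglongrightarrow> 0"
proof (rule inar_slln[where C="1 + \<sigma>2" and b="\<lambda>y. 1 + real y"])
  fix n y
  have "(1 + \<sigma>2) * (1 + real y) \<le> (1 + \<sigma>2) * ((1 + real y) * sqrt (1 + real y))"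
    using sigma2_nonneg by (intro mult_left_mono) (auto intro!: mult_left_mono[of 1, simplified])
  then show "expectation (\<lambda>\<omega>. (D n y \<omega>)\<^sup>2) \<le> (1 + \<sigma>2) * ((1 + real y) * sqrt (1 + real y))"
    using D_square_le[of n y] by linarith
qed (use D_meas_gen[OF src_index(2)] D_mean D_square in auto)

text \<open>The critical case for the exponent 3/2: the variance of \<open>y * D n y\<close> is of
  order \<open>(1 + y)\<close> cubed, which is exactly \<open>b * sqrt b\<close> for
  \<open>b\<close> the square of \<open>1 + y\<close>.\<close>

lemma slln_YD:
  "AE \<omega> in M. (\<lambda>n. (\<Sum>k<n. real (Y k \<omega>) * D k (Y k \<omega>) \<omega>) / (\<Sum>k<n. (1 + real (Y k \<omega>))\<^sup>2)) \<longlonglongrightarrow> 0"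
proof (rule inar_slln[where C="1 + \<sigma>2" and b="\<lambda>y. (1 + real y)\<^sup>2" and U="\<lambda>n y \<omega>. real y * D n y \<omega>"])
  fix n y
  have "expectation (\<lambda>\<omega>. (real y * D n y \<omega>)\<^sup>2) = (real y)\<^sup>2 * expectation (\<lambda>\<omega>. (D n y \<omega>)\<^sup>2)"
    by (simp add: power_mult_distrib)
  also have "\<dots> \<le> (1 + real y)\<^sup>2 * ((1 + \<sigma>2) * (1 + real y))"
    by (intro mult_mono D_square_le power_mono) auto
  finally show "expectation (\<lambda>\<omega>. (real y * D n y \<omega>)\<^sup>2) \<le> (1 + \<sigma>2) * ((1 + real y)\<^sup>2 * sqrt ((1 + real y)\<^sup>2))"
    by (simp add: mult_ac)
  show "1 \<le> (1 + real y)\<^sup>2" by (rule one_le_power) simp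
qed (use D_meas_gen[OF src_index(2)] D_mean D_square in \<open>auto simp: power_mult_distrib\<close>)

text \<open>The increments do not depend on the state and are bounded by 1; the weights
  \<open>1 + Y k\<close> only bring the law into the form used for paths.\<close>

lemma slln_nz:
  "AE \<omega> in M. (\<lambda>n. (\<Sum>k<n. of_bool (eps (Suc k) \<omega> \<noteq> 0) - nz) / (\<Sum>k<n. 1 + real (Y k \<omega>))) \<longlonglongrightarrow> 0"
proof (rule inar_slln[where C=1 and b="\<lambda>y. 1 + real y" and U="\<lambda>n y \<omega>. of_bool (eps (Suc n) \<omega> \<noteq> 0) - nz"])
  fix n y :: nat
  let ?f = "\<lambda>k::nat. of_bool (k \<noteq> 0) - nz :: real"
  have m: "(\<lambda>\<omega>. f (eps (Suc n) \<omega>)) \<in> borel_measurable M" for f :: "nat \<Rightarrow> real"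
    using measurable_compose[OF eps_measurable[of "Suc n"], of f borel] by simp
  have nz1: "0 \<le> nz" "nz \<le> 1"
  proof -
    show "0 \<le> nz" using nz_pos by simp
    have "nz \<le> expectation (\<lambda>\<omega>. 1)"
      unfolding nz_def using m[of "\<lambda>k. of_bool (k \<noteq> 0)"]
      by (intro integral_mono integrable_const_bound[where B=1]) (auto simp: eps_transfer)
    then show "nz \<le> 1" by (simp add: prob_space)
  qed
  have le1: "(?f k)\<^sup>2 \<le> 1" for k using nz1 by (auto simp: abs_square_le_1)
  show "(\<lambda>\<omega>. ?f (eps (Suc n) \<omega>)) \<in> borel_measurable (gen (fresh n))"
    using measurable_compose[OF eps_measurable_gen, of "Suc n" "fresh n" ?f borel] by (simp add: fresh_def)
  have "expectation (\<lambda>\<omega>. of_bool (eps (Suc n) \<omega> \<noteq> 0)) = nz"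
    using eps_transfer(2)[of "Suc n" "\<lambda>k. of_bool (k \<noteq> 0)"] by (simp add: nz_def)
  moreover have "integrable M (\<lambda>\<omega>. of_bool (eps (Suc n) \<omega> \<noteq> 0) :: real)"
    using m[of "\<lambda>k. of_bool (k \<noteq> 0)"] by (intro integrable_const_bound[where B=1]) auto
  ultimately show "expectation (\<lambda>\<omega>. ?f (eps (Suc n) \<omega>)) = 0" by (simp add: prob_space)
  show i: "integrable M (\<lambda>\<omega>. (?f (eps (Suc n) \<omega>))\<^sup>2)"
    using m[of "\<lambda>k. (?f k)\<^sup>2"] le1 by (intro integrable_const_bound[where B=1]) auto
  have "expectation (\<lambda>\<omega>. (?f (eps (Suc n) \<omega>))\<^sup>2) \<le> expectation (\<lambda>\<omega>. 1)"
    by (intro integral_mono i le1) auto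
  moreover have "1 * 1 \<le> (1 + real y) * sqrt (1 + real y)" by (intro mult_mono) auto
  ultimately show "expectation (\<lambda>\<omega>. (?f (eps (Suc n) \<omega>))\<^sup>2) \<le> 1 * ((1 + real y) * sqrt (1 + real y))"
    by (simp add: prob_space)
qed simp

lemma Y_Suc: "real (Y (Suc k) \<omega>) = \<alpha> * Y k \<omega> + \<mu> + D k (Y k \<omega>) \<omega> + (if Suc k = s then real \<theta> else 0)"
  by (simp add: D_def x_def sum_subtractf)

text \<open>With \<open>q\<close> the part of \<open>Y (Suc n) - c\<close> determined by the current
  state, the product is \<open>(D + q) * x\<close>. Its conditional mean comes from
  \<open>D_x1\<close> alone, and as \<open>x\<close> is bounded its second moment grows only
  quadratically in the state.\<close>

lemma slln_Yx:
  "AE \<omega> in M. (\<lambda>n. (\<Sum>k<n. (real (Y (Suc k) \<omega>) - c) * x k 1 \<omega> - \<alpha> * (1 - \<alpha>) * of_bool (1 \<le> Y k \<omega>))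
     / (\<Sum>k<n. (1 + real (Y k \<omega>))\<^sup>2)) \<longlonglongrightarrow> 0"
proof -
  define q where "q n y = \<alpha> * real y + \<mu> + (if Suc n = s then real \<theta> else 0) - c" for n y
  define U where "U n y \<omega> = (D n y \<omega> + q n y) * x n 1 \<omega> - \<alpha> * (1 - \<alpha>) * of_bool (1 \<le> y)" for n y \<omega>
  \<comment> \<open>Chosen so that \<open>\<bar>q n y\<bar> \<le> K * (1 + y)\<close>, whether or
    not the outlier falls in this step.\<close>
  define K where "K = 1 + \<bar>\<mu>\<bar> + real \<theta> + \<bar>c\<bar>"
  define C where "C = 4 * (1 + \<sigma>2) + 4 * K\<^sup>2 + 2"
  have qK: "\<bar>q n y\<bar> \<le> K * (1 + real y)" for n y
  proof -
    have "\<bar>\<alpha> * real y\<bar> \<le> real y" using alpha by (simp add: abs_mult mult_left_le_one_le)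
    then have "\<bar>q n y\<bar> \<le> real y + \<bar>\<mu>\<bar> + real \<theta> + \<bar>c\<bar>" unfolding q_def by auto
    also have "\<dots> \<le> K + K * real y"
    proof -
      have "1 * real y \<le> K * real y" by (intro mult_right_mono) (auto simp: K_def)
      then show ?thesis by (simp add: K_def)
    qed
    finally show ?thesis by (simp add: algebra_simps)
  qed
  have xx: "integrable M (\<lambda>\<omega>. D n y \<omega> * x n 1 \<omega>)" for n y
    using D_square x_moments[of 1 n] by (intro integrable_mult_of_squares) auto
  have Um: "U n y \<in> borel_measurable (gen (fresh n))" for n y
    unfolding U_def[abs_def] using D_meas_gen[OF src_index(2)] x_meas_gen[of n 1 "fresh n"]
    by (intro borel_measurable_diff borel_measurable_times borel_measurable_add) (auto simp: fresh_def)
  have [measurable]: "U n y \<in> borel_measurable M" for n y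
    by (rule measurable_from_subalg[OF subalgebra_M_gen[OF past_fresh(2)] Um])
  have U0: "expectation (U n y) = 0" for n y
  proof -
    have "U n y = (\<lambda>\<omega>. D n y \<omega> * x n 1 \<omega> + q n y * x n 1 \<omega> - \<alpha> * (1 - \<alpha>) * of_bool (1 \<le> y))"
      by (simp add: U_def fun_eq_iff algebra_simps)
    then show ?thesis using xx[of n y] x_moments[of 1 n] D_x1[of n y] by (simp add: prob_space)
  qed
  have a1: "\<bar>\<alpha> * (1 - \<alpha>) * of_bool (1 \<le> y)\<bar> \<le> 1" for y :: nat
    using alpha by (auto simp: abs_mult mult_le_one)
  have ab: "(a - b)\<^sup>2 \<le> 2 * a\<^sup>2 + 2 * b\<^sup>2" "(a + b)\<^sup>2 \<le> 2 * a\<^sup>2 + 2 * b\<^sup>2" for a b :: real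
    using zero_le_power2[of "a + b"] zero_le_power2[of "a - b"]
    unfolding power2_sum power2_diff by linarith+
  \<comment> \<open>Two uses of the quadratic inequality \<open>ab\<close>, with
    \<open>\<bar>x n 1 \<omega>\<bar> \<le> 1\<close> and a centring constant of size at most 1; the
    coefficients reappear in \<open>C\<close>.\<close>
  have Ub: "AE \<omega> in M. (U n y \<omega>)\<^sup>2 \<le> 4 * (D n y \<omega>)\<^sup>2 + (4 * (q n y)\<^sup>2 + 2)" for n y
    using AE_x1_le[of n]
  proof eventually_elim
    case (elim \<omega>)
    have "(U n y \<omega>)\<^sup>2 \<le> 2 * ((D n y \<omega> + q n y) * x n 1 \<omega>)\<^sup>2 + 2 * (\<alpha> * (1 - \<alpha>) * of_bool (1 \<le> y))\<^sup>2"
      unfolding U_def by (rule ab)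
    moreover have "((D n y \<omega> + q n y) * x n 1 \<omega>)\<^sup>2 \<le> (D n y \<omega> + q n y)\<^sup>2 * 1"
      unfolding power_mult_distrib using elim by (intro mult_left_mono) (auto simp: abs_square_le_1)
    moreover have "(\<alpha> * (1 - \<alpha>) * of_bool (1 \<le> y))\<^sup>2 \<le> 1"
      using a1[of y] by (simp only: abs_square_le_1)
    ultimately show ?case using ab(2)[of "D n y \<omega>" "q n y"] by linarith
  qed
  have bi: "integrable M (\<lambda>\<omega>. 4 * (D n y \<omega>)\<^sup>2 + (4 * (q n y)\<^sup>2 + 2))" for n y
    using D_square[of n y] by simp
  have Ui: "integrable M (\<lambda>\<omega>. (U n y \<omega>)\<^sup>2)" for n y
    by (rule Bochner_Integration.integrable_bound[OF bi[of n y]]) (use Ub[of n y] in auto)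
  have "AE \<omega> in M. (\<lambda>n. (\<Sum>k<n. U k (Y k \<omega>) \<omega>) / (\<Sum>k<n. (1 + real (Y k \<omega>))\<^sup>2)) \<longlonglongrightarrow> 0"
  proof (rule inar_slln[where C=C and b="\<lambda>y. (1 + real y)\<^sup>2", OF Um U0 Ui])
    fix n y
    have "expectation (\<lambda>\<omega>. (U n y \<omega>)\<^sup>2) \<le> expectation (\<lambda>\<omega>. 4 * (D n y \<omega>)\<^sup>2 + (4 * (q n y)\<^sup>2 + 2))"
      by (rule integral_mono_AE[OF Ui bi Ub])
    also have "\<dots> = 4 * expectation (\<lambda>\<omega>. (D n y \<omega>)\<^sup>2) + (4 * (q n y)\<^sup>2 + 2)"
      using D_square[of n y] by (simp add: prob_space)
    also have "\<dots> \<le> 4 * ((1 + \<sigma>2) * (1 + real y)^2) + (4 * (K\<^sup>2 * (1 + real y)\<^sup>2) + 2 * (1 + real y)\<^sup>2)"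
    proof (intro add_mono mult_left_mono)
      have "(1 + real y) \<le> (1 + real y)\<^sup>2" by (simp add: power2_eq_square)
      then have "(1 + \<sigma>2) * (1 + real y) \<le> (1 + \<sigma>2) * (1 + real y)\<^sup>2"
        using sigma2_nonneg by (intro mult_left_mono) auto
      then show "expectation (\<lambda>\<omega>. (D n y \<omega>)\<^sup>2) \<le> (1 + \<sigma>2) * (1 + real y)\<^sup>2"
        using D_square_le[of n y] by linarith
      show "(q n y)\<^sup>2 \<le> K\<^sup>2 * (1 + real y)\<^sup>2"
        using power_mono[OF qK[of n y] abs_ge_zero, of 2] by (simp add: power_mult_distrib)
      have "1 \<le> (1 + real y)\<^sup>2" by (rule one_le_power) simp
      then show "2 \<le> 2 * (1 + real y)\<^sup>2" by simp
    qed auto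
    also have "\<dots> = C * (1 + real y)\<^sup>2 * 1" by (simp add: C_def algebra_simps)
    also have "\<dots> \<le> C * (1 + real y)\<^sup>2 * sqrt ((1 + real y)\<^sup>2)"
      using sigma2_nonneg by (intro mult_left_mono) (auto simp: C_def)
    finally show "expectation (\<lambda>\<omega>. (U n y \<omega>)\<^sup>2) \<le> C * ((1 + real y)\<^sup>2 * sqrt ((1 + real y)\<^sup>2))"
      by (simp add: mult.assoc)
    show "1 \<le> (1 + real y)\<^sup>2" by (rule one_le_power) simp
  qed
  moreover have "U k (Y k \<omega>) \<omega>
      = (real (Y (Suc k) \<omega>) - c) * x k 1 \<omega> - \<alpha> * (1 - \<alpha>) * of_bool (1 \<le> Y k \<omega>)" for k \<omega>
    unfolding U_def q_def Y_Suc by (simp add: algebra_simps)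
  ultimately show ?thesis by simp
qed

text \<open>Four strong laws and the countably many bounds on \<open>x k 1\<close> hold
  simultaneously outside a null set; from here on all arguments are deterministic on a single
  path.\<close>

lemma AE_inar_path:
  "AE \<omega> in M. inar_path (\<lambda>k. real (Y k \<omega>)) (\<lambda>k. D k (Y k \<omega>) \<omega>) (\<lambda>k. x k 1 \<omega>)
     (\<lambda>k. of_bool (1 \<le> Y k \<omega>)) (\<lambda>k. of_bool (eps (Suc k) \<omega> \<noteq> 0)) \<alpha> \<mu> (real \<theta>) (\<alpha> * (1 - \<alpha>)) nz s"
proof -
  have "AE \<omega> in M. \<forall>k. \<bar>x k 1 \<omega>\<bar> \<le> 1"
    unfolding AE_all_countable by (intro allI AE_x1_le)
  from this slln_D slln_YD slln_nz slln_Yx[of "\<mu> / (1 - \<alpha>)"] show ?thesis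
  proof eventually_elim
    case (elim \<omega>)
    show ?case
      by (rule inar_path.intro[OF _ alpha(2) _ nz_pos _ Y_Suc _ _ _ elim(2,3,5,4)])
         (use alpha elim(1) in simp_all)
  qed
qed

end

section \<open>Unique minimizer and strong consistency\<close>

theorem theorem4p3p1:
  fixes M :: "'a measure"
    and Y0 :: "'a \<Rightarrow> nat"
    and eps :: "nat \<Rightarrow> 'a \<Rightarrow> nat"
    and xi :: "nat \<Rightarrow> nat \<Rightarrow> 'a \<Rightarrow> nat"
    and \<alpha> :: real
    and s \<theta> :: nat
  assumes M: "prob_space M"
    and alpha: "0 < \<alpha>" "\<alpha> < 1"
    and s: "1 \<le> s" and theta: "1 \<le> \<theta>"
    and indep: "prob_space.indep_vars M (\<lambda>_. count_space UNIV) (inar_family Y0 eps xi) inar_index"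
    and eps_id: "\<And>k. 1 \<le> k \<Longrightarrow>
                   distr M (count_space UNIV) (eps k) = distr M (count_space UNIV) (eps 1)"
    and eps_sq: "integrable M (\<lambda>\<omega>. (real (eps 1 \<omega>))\<^sup>2)"
    and eps_nz: "measure M {\<omega> \<in> space M. eps 1 \<omega> \<noteq> 0} > 0"
    and xi_bern: "\<And>k j. 1 \<le> k \<Longrightarrow> 1 \<le> j \<Longrightarrow>
                   distr M (count_space UNIV) (xi k j) = measure_pmf (map_pmf of_bool (bernoulli_pmf \<alpha>))"
    and Y0_sq: "integrable M (\<lambda>\<omega>. (real (Y0 \<omega>))\<^sup>2)"
  shows
    "(AE \<omega> in M. \<exists>n0 \<ge> s. \<forall>n \<ge> n0.
        (let y = (\<lambda>k. real (inarY Y0 eps xi s \<theta> k \<omega>))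
         in {p. \<forall>q. Qn s n y p \<le> Qn s n y q} = {(alpha_hat s n y, mu_hat s n y, theta_hat s n y)}))
     \<and> (AE \<omega> in M.
        let y = (\<lambda>k. real (inarY Y0 eps xi s \<theta> k \<omega>));
            \<mu>\<epsilon> = integral\<^sup>L M (\<lambda>\<omega>'. real (eps 1 \<omega>'))
        in (\<lambda>n. alpha_hat s n y) \<longlonglongrightarrow> \<alpha>
         \<and> (\<lambda>n. mu_hat s n y) \<longlonglongrightarrow> \<mu>\<epsilon>
         \<and> (\<lambda>n. theta_hat s n y) \<longlonglongrightarrow> y s - \<alpha> * y (s - 1) - \<mu>\<epsilon>)"
proof -
  interpret prob_space M by (rule M)
  interpret inar M Y0 eps xi \<alpha> s \<theta>
    by unfold_locales (rule alpha indep eps_id eps_sq eps_nz xi_bern; assumption?)+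
  show ?thesis
  proof (intro conjI)
    show "AE \<omega> in M. \<exists>n0 \<ge> s. \<forall>n \<ge> n0.
        (let y = (\<lambda>k. real (Y k \<omega>))
         in {p. \<forall>q. Qn s n y p \<le> Qn s n y q} = {(alpha_hat s n y, mu_hat s n y, theta_hat s n y)})"
      using AE_inar_path
    proof eventually_elim
      case (elim \<omega>)
      \<comment> \<open>Positivity of the determinant suffices for the unique minimizer, and it
        holds from some index on along almost every path; \<open>n \<ge> s\<close> is imposed as
        well so that the observation at \<open>s\<close> is in the sample.\<close>
      obtain N where N: "\<And>n. N \<le> n \<Longrightarrow> 0 < Dn s n (\<lambda>k. real (Y k \<omega>))"
        using inar_path.Dn_pos[OF elim s] unfolding eventually_sequentially by blast
      show ?case
        unfolding Let_def
      proof (intro exI[of _ "max s N"] conjI allI impI)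
        fix n assume "max s N \<le> n"
        then show "{p. \<forall>q. Qn s n (\<lambda>k. real (Y k \<omega>)) p \<le> Qn s n (\<lambda>k. real (Y k \<omega>)) q}
          = {(alpha_hat s n (\<lambda>k. real (Y k \<omega>)), mu_hat s n (\<lambda>k. real (Y k \<omega>)),
              theta_hat s n (\<lambda>k. real (Y k \<omega>)))}"
          by (intro Qn_minimizer_unique s N) auto
      qed simp
    qed
    show "AE \<omega> in M.
        let y = (\<lambda>k. real (Y k \<omega>));
            \<mu>\<epsilon> = integral\<^sup>L M (\<lambda>\<omega>'. real (eps 1 \<omega>'))
        in (\<lambda>n. alpha_hat s n y) \<longlonglongrightarrow> \<alpha>
         \<and> (\<lambda>n. mu_hat s n y) \<longlonglongrightarrow> \<mu>\<epsilon>
         \<and> (\<lambda>n. theta_hat s n y) \<longlonglongrightarrow> y s - \<alpha> * y (s - 1) - \<mu>\<epsilon>"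
      using AE_inar_path
    proof eventually_elim
      case (elim \<omega>)
      show ?case
        using inar_path.estimators_consistent[OF elim s] unfolding Let_def \<mu>_def by blast
    qed
  qed
qed

end
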